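(* Let $\alpha$ be an epsilon number and $B\subseteq\alpha^+$ finite with $B\cap[\alpha,\alpha^+)\neq\emptyset$. Let $FB$ be the set of all $(<,<_1,+)$-isomorphisms $h:\Delta(\alpha,B)\to h[\Delta(\alpha,B)]\subseteq\alpha$ with $h(x)=x$ for all $x\in\Delta(\alpha,B)\cap\alpha$. Then for every $h\in FB$ we have $h(\alpha)\in\alpha\cap\mathbb{E}$ and: (a) for all $x\in\Delta(\alpha,B)$: $\mathrm{Ep}(x)\cap\alpha\subseteq h(\alpha)$ and $x[\alpha:=h(\alpha)]\le h(x)$; (b) if $\alpha\le_1\max\Delta(\alpha,B)$, then the map $H:\Delta(\alpha,B)\to H[\Delta(\alpha,B)]$, $H(x):=x[\alpha:=h(\alpha)]$, is an $(<,<_1,+,\lambda x.\omega^x)$-isomorphism with $H(x)=x$ for all $x\in\Delta(\alpha,B)\cap\alpha$.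
   Context: $\mathbb{P}=\{\omega^\xi\}$; $\mathbb{E}$ = epsilon numbers; $x^+:=\min\{e\in\mathbb{E}:e>x\}$; $x=_{\mathrm{CNF}}L_1l_1+\dots+L_nl_n$ is Cantor normal form ($L_1>\dots>L_n$ in $\mathbb{P}$, $0<l_i<\omega$). $\mathrm{Ep}(x)$: $\{x\}$ if $x\in\mathbb{E}$; $\mathrm{Ep}(L_1)\cup\dots\cup\mathrm{Ep}(L_n)$ if $x\notin\mathbb{E}$, $x=_{\mathrm{CNF}}L_1l_1+\dots+L_nl_n$, $n\ge2$ or $l_1\ge2$; $\mathrm{Ep}(L)$ if $x\notin\mathbb{E}$, $x=_{\mathrm{CNF}}\omega^L$; $\mathrm{Ep}(0)=\emptyset$. Substitution for $\alpha,e\in\mathbb{E}$: $x[\alpha:=e]=x$ if $x\in\mathbb{E}\setminus\{\alpha\}$; $=e$ if $x=\alpha$; $=L_1[\alpha:=e]l_1+\dots+L_n[\alpha:=e]l_n$ if $x\notin\mathbb{E}$, $x=_{\mathrm{CNF}}L_1l_1+\dots+L_nl_n$, $n\ge2$ or $l_1\ge2$; $=\omega^{L[\alpha:=e]}$ if $x\notin\mathbb{E}$, $x=_{\mathrm{CNF}}\omega^L$. Cover sets: For $L\in\mathbb{P}$: if $L\in\mathbb{E}\cup\{1\}$, $F(L):=\{L\}$; if $L=\omega^Z\notin\mathbb{E}$ with $Z=_{\mathrm{CNF}}\sum_{j=1}^k\omega^{V_j}v_j$, then $F(L):=\{\omega^{\omega^{V_1}v_1+\dots+\omega^{V_{g-1}}v_{g-1}+\omega^{V_g}\cdot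 j} : g\in[1,k], j\in[1,v_g]\}\cup\{\omega^{\omega^{V_1}v_1+\dots+\omega^{V_{g-1}}v_{g-1}+\omega^{V_g}\cdot j}+V_g : g\in[1,k], j\in[1,v_g]\}$. For $\delta=_{\mathrm{CNF}}L_1l_1+\dots+L_nl_n$: $C_1(\delta):=\bigcup_{L_i\notin\mathbb{E}}F(L_i)$; $C_2(\delta):=\{L_ij: i\in[1,n], j\in[1,l_i]\}\cup\{\sum_{i=1}^jL_il_i: j\in[1,n]\}$; $Y(\delta):=\{V_{ij}: L_i\notin\mathbb{E}, L_i=\omega^Z, Z=_{\mathrm{CNF}}\sum_{j}\omega^{V_{ij}}v_{ij}\}$; and recursively $C(\delta):=C_1(\delta)\cup\bigcup_{\sigma\in C_1(\delta)}C_2(\sigma)\cup C_2(\delta)\cup\bigcup_{V\in Y(\delta)}C(V)$. For $\delta<\alpha^+$: $D(\alpha,\delta):=C(\delta)\cup\{\alpha,\alpha\cdot2\}$; for finite $B\subseteq\alpha^+$: $\Delta(\alpha,B):=B\cup\bigcup_{\delta\in B\cap[\alpha,\alpha^+)}D(\alpha,\delta)$. For finite $Z,\tilde Z$, a bijection $h:Z\to\tilde Z$ is an $(<,<_1,+)$-isomorphism if for $x,y,z\in Z$: $x<y\iff h(x)<h(y)$, $x<_1y\iff h(x)<_1h(y)$, $x+y=z\iff h(x)+h(y)=h(z)$; an $(<,<_1,+,\lambda x.\omega^x)$-isomorphism if also $\omega^x=y\iff\omega^{h(x)}=h(y)$. Carlson's $<_1$ (recursion on $\beta$): $\alpha<_1\beta$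 iff $\alpha<\beta$ and every finite $B\subseteq\beta$ admits an $(<,<_1,+)$-isomorphism $h:B\to h[B]\subseteq\alpha$ fixing $B\cap\alpha$ pointwise; $\alpha\le_1\beta$ iff $\alpha<_1\beta$ or $\alpha=\beta$. *)

theory Defs
  imports Main "HOL-Library.Equipollence" "HOL-Library.Countable_Set"
begin

text \<open>The ordinals are modelled by the elements of a type of class wellorder: every
element x is identified with the order type of the initial segment below x.  The
ordinal operations are defined by the usual transfinite recursions.  The main
theorem assumes that the type is an uncountable initial ordinal (every proper
initial segment has smaller cardinality than the whole type), so that all ordinals
occurring in the statement exist in the type and the recursions are the genuine
ordinal operations.\<close>

definition ord_rel :: "('a::wellorder \<times> 'a) set" where
  "ord_rel = {(x, y). x < y}"

definition ozero :: "'a::wellorder" where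
  "ozero = (LEAST x. True)"

definition osucc :: "'a::wellorder \<Rightarrow> 'a" where
  "osucc x = (LEAST y. x < y)"

definition opred :: "'a::wellorder \<Rightarrow> 'a" where
  "opred y = (THE z. osucc z = y)"

definition olimit :: "'a::wellorder \<Rightarrow> bool" where
  "olimit x \<longleftrightarrow> x \<noteq> ozero \<and> (\<forall>y<x. osucc y < x)"

definition osup :: "'a::wellorder set \<Rightarrow> 'a" where
  "osup S = (LEAST w. \<forall>s\<in>S. s \<le> w)"

definition oadd :: "'a::wellorder \<Rightarrow> 'a \<Rightarrow> 'a" where
  "oadd x = wfrec ord_rel (\<lambda>f y. if y = ozero then x
       else if olimit y then osup (f ` {..<y}) else osucc (f (opred y)))"

definition omul :: "'a::wellorder \<Rightarrow> 'a \<Rightarrow> 'a" where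
  "omul x = wfrec ord_rel (\<lambda>f y. if y = ozero then ozero
       else if olimit y then osup (f ` {..<y}) else oadd (f (opred y)) x)"

definition oomega :: "'a::wellorder" where
  "oomega = (LEAST x. olimit x)"

definition oexp :: "'a::wellorder \<Rightarrow> 'a" where
  "oexp = wfrec ord_rel (\<lambda>f y. if y = ozero then osucc ozero
       else if olimit y then osup (f ` {..<y}) else omul (f (opred y)) oomega)"

definition is_eps :: "'a::wellorder \<Rightarrow> bool" where
  "is_eps x \<longleftrightarrow> oexp x = x"

definition principal :: "'a::wellorder \<Rightarrow> bool" where
  "principal x \<longleftrightarrow> (\<exists>\<xi>. oexp \<xi> = x)"

definition next_eps :: "'a::wellorder \<Rightarrow> 'a" where
  "next_eps x = (LEAST e. is_eps e \<and> x < e)"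

definition olog :: "'a::wellorder \<Rightarrow> 'a" where
  "olog x = (THE L. oexp L = x)"

fun ntimes :: "'a::wellorder \<Rightarrow> nat \<Rightarrow> 'a" where
  "ntimes L 0 = ozero"
| "ntimes L (Suc n) = oadd (ntimes L n) L"

text \<open>Cantor normal form: lists [(L_1,l_1),...,(L_n,l_n)] with L_1 > ... > L_n principal,
0 < l_i < omega, denoting L_1 l_1 + ... + L_n l_n.\<close>
definition cnf_val :: "('a::wellorder \<times> nat) list \<Rightarrow> 'a" where
  "cnf_val xs = foldl oadd ozero (map (\<lambda>(L, l). ntimes L l) xs)"

definition is_cnf :: "('a::wellorder \<times> nat) list \<Rightarrow> bool" where
  "is_cnf xs \<longleftrightarrow> sorted_wrt (\<lambda>a b. fst b < fst a) xs
      \<and> (\<forall>p\<in>set xs. principal (fst p) \<and> 0 < snd p)"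

definition cnf :: "'a::wellorder \<Rightarrow> ('a \<times> nat) list" where
  "cnf x = (THE xs. is_cnf xs \<and> cnf_val xs = x)"

definition cnf_multi :: "'a::wellorder \<Rightarrow> bool" where
  "cnf_multi x \<longleftrightarrow> 2 \<le> length (cnf x) \<or> (length (cnf x) = 1 \<and> 2 \<le> snd (hd (cnf x)))"

definition Ep :: "'a::wellorder \<Rightarrow> 'a set" where
  "Ep = wfrec ord_rel (\<lambda>f x. if is_eps x then {x}
       else if x = ozero then {}
       else if cnf_multi x then (\<Union>L\<in>fst ` set (cnf x). f L)
       else f (olog x))"

definition subst :: "'a::wellorder \<Rightarrow> 'a \<Rightarrow> 'a \<Rightarrow> 'a" where
  "subst a e = wfrec ord_rel (\<lambda>f x. if is_eps x then (if x = a then e else x)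
       else if x = ozero then ozero
       else if cnf_multi x then foldl oadd ozero (map (\<lambda>(L, l). ntimes (f L) l) (cnf x))
       else oexp (f (olog x)))"

text \<open>omega^{V_1} v_1 + ... + omega^{V_{g-1}} v_{g-1} + omega^{V_g} j, where
Z = cnf_val zs, zs = [(omega^{V_1},v_1),...], and g is 1-based.\<close>
definition cnf_prefix :: "('a::wellorder \<times> nat) list \<Rightarrow> nat \<Rightarrow> nat \<Rightarrow> 'a" where
  "cnf_prefix zs g j = oadd (cnf_val (take (g - 1) zs)) (ntimes (fst (zs ! (g - 1))) j)"

definition Fcov :: "'a::wellorder \<Rightarrow> 'a set" where
  "Fcov L = (if is_eps L \<or> L = osucc ozero then {L}
     else (let zs = cnf (olog L) in
       {oexp (cnf_prefix zs g j) | g j. 1 \<le> g \<and> g \<le> length zs \<and> 1 \<le> j \<and> j \<le> snd (zs ! (g - 1))}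
     \<union> {oadd (oexp (cnf_prefix zs g j)) (olog (fst (zs ! (g - 1)))) | g j.
            1 \<le> g \<and> g \<le> length zs \<and> 1 \<le> j \<and> j \<le> snd (zs ! (g - 1))}))"

definition C1 :: "'a::wellorder \<Rightarrow> 'a set" where
  "C1 \<delta> = (\<Union>L\<in>{L \<in> fst ` set (cnf \<delta>). \<not> is_eps L}. Fcov L)"

definition C2 :: "'a::wellorder \<Rightarrow> 'a set" where
  "C2 \<delta> = {ntimes L j | L l j. (L, l) \<in> set (cnf \<delta>) \<and> 1 \<le> j \<and> j \<le> l}
        \<union> {cnf_val (take j (cnf \<delta>)) | j. 1 \<le> j \<and> j \<le> length (cnf \<delta>)}"

definition Ycov :: "'a::wellorder \<Rightarrow> 'a set" where
  "Ycov \<delta> = {olog M | L M. L \<in> fst ` set (cnf \<delta>) \<and> \<not> is_eps L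
                          \<and> M \<in> fst ` set (cnf (olog L))}"

definition Ccov :: "'a::wellorder \<Rightarrow> 'a set" where
  "Ccov = wfrec ord_rel (\<lambda>f \<delta>. C1 \<delta> \<union> (\<Union>\<sigma>\<in>C1 \<delta>. C2 \<sigma>) \<union> C2 \<delta> \<union> (\<Union>V\<in>Ycov \<delta>. f V))"

definition Dcov :: "'a::wellorder \<Rightarrow> 'a \<Rightarrow> 'a set" where
  "Dcov \<alpha> \<delta> = Ccov \<delta> \<union> {\<alpha>, ntimes \<alpha> 2}"

definition Delta :: "'a::wellorder \<Rightarrow> 'a set \<Rightarrow> 'a set" where
  "Delta \<alpha> B = B \<union> (\<Union>\<delta>\<in>{\<delta> \<in> B. \<alpha> \<le> \<delta> \<and> \<delta> < next_eps \<alpha>}. Dcov \<alpha> \<delta>)"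

text \<open>h : Z -> h[Z] is a (<, R, +)-isomorphism (R plays the role of <_1).\<close>
definition iso_plus :: "('a::wellorder \<Rightarrow> 'a \<Rightarrow> bool) \<Rightarrow> 'a set \<Rightarrow> ('a \<Rightarrow> 'a) \<Rightarrow> bool" where
  "iso_plus R Z h \<longleftrightarrow> inj_on h Z
     \<and> (\<forall>x\<in>Z. \<forall>y\<in>Z. (x < y \<longleftrightarrow> h x < h y) \<and> (R x y \<longleftrightarrow> R (h x) (h y)))
     \<and> (\<forall>x\<in>Z. \<forall>y\<in>Z. \<forall>z\<in>Z. oadd x y = z \<longleftrightarrow> oadd (h x) (h y) = h z)"

definition lt1_set :: "'a::wellorder \<Rightarrow> 'a set" where
  "lt1_set = wfrec ord_rel (\<lambda>f \<beta>. {a. a < \<beta> \<and>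
       (\<forall>B. finite B \<and> B \<subseteq> {..<\<beta>} \<longrightarrow>
          (\<exists>h. iso_plus (\<lambda>x y. x \<in> f y) B h \<and> h ` B \<subseteq> {..<a}
               \<and> (\<forall>x\<in>B. x < a \<longrightarrow> h x = x)))})"

definition lt1 :: "'a::wellorder \<Rightarrow> 'a \<Rightarrow> bool" where
  "lt1 a b \<longleftrightarrow> a \<in> lt1_set b"

definition le1 :: "'a::wellorder \<Rightarrow> 'a \<Rightarrow> bool" where
  "le1 a b \<longleftrightarrow> lt1 a b \<or> a = b"

definition iso_plus_omega :: "'a::wellorder set \<Rightarrow> ('a \<Rightarrow> 'a) \<Rightarrow> bool" where
  "iso_plus_omega Z h \<longleftrightarrow> iso_plus lt1 Z h
     \<and> (\<forall>x\<in>Z. \<forall>y\<in>Z. oexp x = y \<longleftrightarrow> oexp (h x) = h y)"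

definition FB :: "'a::wellorder \<Rightarrow> 'a set \<Rightarrow> ('a \<Rightarrow> 'a) set" where
  "FB \<alpha> B = {h. iso_plus lt1 (Delta \<alpha> B) h \<and> h ` Delta \<alpha> B \<subseteq> {..<\<alpha>}
                 \<and> (\<forall>x\<in>Delta \<alpha> B. x < \<alpha> \<longrightarrow> h x = x)}"

definition big_ordinal_type :: "'a::wellorder itself \<Rightarrow> bool" where
  "big_ordinal_type _ \<longleftrightarrow> uncountable (UNIV :: 'a set)
      \<and> (\<forall>x::'a. {..<x} \<prec> (UNIV :: 'a set))"

end

theory Submission
  imports Defs
begin

text \<open>Everything rests on a description of the \<open>y\<close> with \<open>x <\<^sub>1 y\<close> when \<open>x\<close> is not an epsilon number.
  Write an additively principal \<open>x\<close> other than \<open>1\<close> as \<open>x = \<omega>(z + \<omega>\<^sup>v)\<close>, so that \<open>v\<close> is the last exponent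
  of the exponent of \<open>x\<close>. Then \<open>x \<le>\<^sub>1 x + \<xi>\<close> for all \<open>\<xi> \<le> v\<close>: a finite subset of \<open>x + \<xi>\<close> is reflected below
  \<open>x\<close> by moving \<open>x + \<eta>\<close> to \<open>x' + \<eta>\<close>, where \<open>x' = \<omega>(z + \<omega>\<^sup>u\<cdot>k)\<close> is close enough to \<open>x\<close> and \<open>\<eta> \<le> u < v\<close>.
  If \<open>v < x\<close>, that is, if \<open>x\<close> is not an epsilon number, then \<open>x <\<^sub>1 x + v + 1\<close> fails, because
  reflecting \<open>{\<omega>\<^sup>z, v, x, x + v}\<close> would produce some \<open>x' <\<^sub>1 x' + v\<close> whose last exponent is less than \<open>v\<close>.
  In particular \<open>x <\<^sub>1 x + x\<close> characterises the epsilon numbers, so \<open>h(\<alpha>)\<close> is one.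

  The cover sets contain, along the exponent of each principal term, the elements \<open>u\<close> and \<open>u + v\<close> with
  \<open>u <\<^sub>1 u + v\<close>. The map \<open>h\<close> preserves this relation, so the last exponent belonging to \<open>h(u)\<close> is at least \<open>h(v)\<close>, and
  induction gives \<open>x[\<alpha> := h(\<alpha>)] \<le> h(x)\<close>. The description of \<open><\<^sub>1\<close> is invariant under the
  substitution, which handles pairs above \<open>\<alpha>\<close>; the remaining pairs reduce to \<open>h\<close> by means of
  \<open>\<alpha> \<le>\<^sub>1 max \<Delta>(\<alpha>, B)\<close> and part (a).\<close>

section \<open>Recursion along the well-order, suprema, and first properties of
  \<open>lt1\<close>\<close>

lemma wf_ord_rel: "wf (ord_rel :: ('a::wellorder \<times> 'a) set)"
  unfolding ord_rel_def by (rule wellorder_class.wf)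

lemma cut_ord_rel [simp]: "z < y \<Longrightarrow> cut f ord_rel y z = f z"
  by (simp add: cut_def ord_rel_def)

lemma ozero_le [simp]: "ozero \<le> (x::'a::wellorder)"
  unfolding ozero_def by (rule Least_le) simp

lemma not_less_ozero [simp]: "\<not> (x::'a::wellorder) < ozero"
  by (simp add: not_less)

lemma le_ozero_iff [simp]: "(x::'a::wellorder) \<le> ozero \<longleftrightarrow> x = ozero"
  by (simp add: order.antisym)

lemma ozero_less_iff: "ozero < (x::'a::wellorder) \<longleftrightarrow> x \<noteq> ozero"
  using le_less not_less_ozero ozero_le by metis

lemma osup_le: "(\<And>s. s \<in> S \<Longrightarrow> s \<le> w) \<Longrightarrow> osup S \<le> w"
  unfolding osup_def by (rule Least_le) blast

lemma osup_upper:
  assumes "\<And>t. t \<in> S \<Longrightarrow> t \<le> w" "s \<in> S"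
  shows "s \<le> osup S"
proof -
  have "\<forall>s\<in>S. s \<le> osup S"
    unfolding osup_def by (rule LeastI[of _ w]) (use assms in blast)
  then show ?thesis using assms by blast
qed

lemma iso_plus_cong:
  assumes "\<And>x y. x \<in> B \<Longrightarrow> y \<in> B \<Longrightarrow> R x y = R' x y \<and> R (h x) (h y) = R' (h x) (h y)"
  shows "iso_plus R B h \<longleftrightarrow> iso_plus R' B h"
  using assms unfolding iso_plus_def by simp

lemma iso_plusD:
  assumes "iso_plus R B h" "x \<in> B" "y \<in> B"
  shows "h x < h y \<longleftrightarrow> x < y" "R (h x) (h y) \<longleftrightarrow> R x y"
    "z \<in> B \<Longrightarrow> oadd (h x) (h y) = h z \<longleftrightarrow> oadd x y = z"
  using assms by (auto simp: iso_plus_def)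

lemma iso_plus_comp:
  assumes "iso_plus R B h" "iso_plus R (h ` B) g"
  shows "iso_plus R B (g \<circ> h)"
  using assms unfolding iso_plus_def by (auto intro: comp_inj_on)

text \<open>The recursion sees \<open>lt1_set\<close> only through its cut at \<open>b\<close>. The
  finite set lies below \<open>b\<close>, and its image lies below \<open>a\<close>, hence also
  below \<open>b\<close>. So the cut never changes a pair that an isomorphism compares, and the full
  relation may replace it.\<close>

lemma lt1_iff:
  fixes a b :: "'a::wellorder"
  shows "lt1 a b \<longleftrightarrow> a < b \<and> (\<forall>B. finite B \<and> B \<subseteq> {..<b} \<longrightarrow>
    (\<exists>h. iso_plus lt1 B h \<and> h ` B \<subseteq> {..<a} \<and> (\<forall>x\<in>B. x < a \<longrightarrow> h x = x)))"
proof -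
  define R :: "'a \<Rightarrow> 'a \<Rightarrow> bool" where "R = (\<lambda>x y. x \<in> cut lt1_set ord_rel b y)"
  have R: "iso_plus R B h \<longleftrightarrow> iso_plus lt1 B h" if "B \<subseteq> {..<b}" "h ` B \<subseteq> {..<a}" "a < b" for B h
  proof (rule iso_plus_cong)
    fix x y assume "x \<in> B" "y \<in> B"
    then have "y < b" "h y < b" using that by (auto intro: order.strict_trans)
    then show "R x y = lt1 x y \<and> R (h x) (h y) = lt1 (h x) (h y)" by (simp add: R_def lt1_def)
  qed
  have ex_cong: "(\<exists>h. iso_plus R B h \<and> h ` B \<subseteq> {..<a} \<and> P h) \<longleftrightarrow> (\<exists>h. iso_plus lt1 B h \<and> h ` B \<subseteq> {..<a} \<and> P h)"
    if "B \<subseteq> {..<b}" "a < b" for B P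
    using R[OF that(1) _ that(2)] by blast
  have "lt1 a b \<longleftrightarrow> a < b \<and> (\<forall>B. finite B \<and> B \<subseteq> {..<b} \<longrightarrow>
    (\<exists>h. iso_plus R B h \<and> h ` B \<subseteq> {..<a} \<and> (\<forall>x\<in>B. x < a \<longrightarrow> h x = x)))"
    unfolding lt1_def R_def def_wfrec[OF eq_reflection[OF lt1_set_def] wf_ord_rel, of b] mem_Collect_eq ..
  then show ?thesis using ex_cong by (simp cong: conj_cong imp_cong)
qed

lemma lt1_less: "lt1 a b \<Longrightarrow> a < b"
  by (drule lt1_iff[THEN iffD1]) (rule conjunct1)

lemma lt1I:
  assumes "a < b"
    "\<And>B. finite B \<Longrightarrow> B \<subseteq> {..<b} \<Longrightarrow>
      \<exists>h. iso_plus lt1 B h \<and> h ` B \<subseteq> {..<a} \<and> (\<forall>x\<in>B. x < a \<longrightarrow> h x = x)"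
  shows "lt1 a b"
  by (rule lt1_iff[THEN iffD2]) (use assms in blast)

lemma lt1E:
  assumes "lt1 a b" "finite B" "B \<subseteq> {..<b}"
  obtains h where "iso_plus lt1 B h" "h ` B \<subseteq> {..<a}" "\<And>x. x \<in> B \<Longrightarrow> x < a \<Longrightarrow> h x = x"
proof -
  have "\<exists>h. iso_plus lt1 B h \<and> h ` B \<subseteq> {..<a} \<and> (\<forall>x\<in>B. x < a \<longrightarrow> h x = x)"
    using lt1_iff[THEN iffD1, OF assms(1), THEN conjunct2, rule_format, of B] assms(2,3) by simp
  with that show ?thesis by blast
qed

lemma lt1_downward:
  assumes "lt1 a c" "a < b" "b \<le> c"
  shows "lt1 a b"
proof (rule lt1I)
  fix B assume B: "finite B" "B \<subseteq> {..<b}"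
  then have "B \<subseteq> {..<c}" using assms(3) by auto
  with assms(1) B(1) show "\<exists>h. iso_plus lt1 B h \<and> h ` B \<subseteq> {..<a} \<and> (\<forall>x\<in>B. x < a \<longrightarrow> h x = x)"
    by (metis lt1E)
qed (rule assms)

text \<open>Reflect a finite set first below \<open>b\<close> and then below \<open>a\<close>.
  Points below \<open>a\<close> are also below \<open>b\<close>, so both reflections fix
  them.\<close>

lemma lt1_trans:
  assumes ab: "lt1 a b" and bc: "lt1 b c"
  shows "lt1 a c"
proof (rule lt1I)
  show "a < c" using lt1_less[OF ab] lt1_less[OF bc] by (rule order.strict_trans)
  fix B assume B: "finite B" "B \<subseteq> {..<c}"
  obtain h where h: "iso_plus lt1 B h" "h ` B \<subseteq> {..<b}" "\<And>x. x \<in> B \<Longrightarrow> x < b \<Longrightarrow> h x = x"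
    using lt1E[OF bc B] by blast
  obtain g where g: "iso_plus lt1 (h ` B) g" "g ` h ` B \<subseteq> {..<a}" "\<And>x. x \<in> h ` B \<Longrightarrow> x < a \<Longrightarrow> g x = x"
    using lt1E[OF ab finite_imageI[OF B(1)] h(2)] by blast
  have "(g \<circ> h) x = x" if "x \<in> B" "x < a" for x
  proof -
    have "h x = x" using that(1) order.strict_trans[OF that(2) lt1_less[OF ab]] by (rule h(3))
    moreover have "h x \<in> h ` B" using that by blast
    ultimately show ?thesis using g(3) that by auto
  qed
  moreover have "iso_plus lt1 B (g \<circ> h)" "(g \<circ> h) ` B \<subseteq> {..<a}"
    using iso_plus_comp[OF h(1) g(1)] g(2) by (simp_all add: image_comp)
  ultimately show "\<exists>h. iso_plus lt1 B h \<and> h ` B \<subseteq> {..<a} \<and> (\<forall>x\<in>B. x < a \<longrightarrow> h x = x)"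
    by blast
qed

section \<open>Ordinal arithmetic\<close>

locale big_ordinals =
  fixes ty :: "'a::wellorder itself"
  assumes big: "big_ordinal_type ty"
begin

abbreviation zero :: 'a ("\<zero>") where "\<zero> \<equiv> ozero"
abbreviation add :: "'a \<Rightarrow> 'a \<Rightarrow> 'a" (infixl "\<oplus>" 65) where "x \<oplus> y \<equiv> oadd x y"
abbreviation mult :: "'a \<Rightarrow> nat \<Rightarrow> 'a" (infixl "\<odot>" 70) where "x \<odot> n \<equiv> ntimes x n"
abbreviation expo :: "'a \<Rightarrow> 'a" ("\<omega>") where "\<omega> \<equiv> oexp"
abbreviation lt1_rel :: "'a \<Rightarrow> 'a \<Rightarrow> bool" (infix "\<lhd>" 50) where "x \<lhd> y \<equiv> lt1 x y"
abbreviation le1_rel :: "'a \<Rightarrow> 'a \<Rightarrow> bool" (infix "\<unlhd>" 50) where "x \<unlhd> y \<equiv> le1 x y"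

text \<open>All elements that a transfinite recursion produces from elements below \<open>c\<close> have at most
  the cardinality of \<open>c\<close>, so no supremum taken in the recursion leaves the type.\<close>

definition small :: "'a \<Rightarrow> 'a \<Rightarrow> bool" where
  "small c x \<longleftrightarrow> {..<x} \<lesssim> {..<c}"

text \<open>If all initial segments were finite, their cardinalities would inject the type into the
  natural numbers, contrary to its uncountability.\<close>

lemma infinite_segment: "\<exists>x::'a. infinite {..<x}"
proof (rule ccontr)
  assume "\<nexists>x::'a. infinite {..<x}"
  then have fin: "finite {..<x}" for x :: 'a by blast
  have "card {..<x} < card {..<y}" if "x < y" for x y :: 'a
    using that fin by (intro psubset_card_mono) auto
  then have "inj (\<lambda>x::'a. card {..<x})"
    by (metis (no_types, lifting) injI less_irrefl linorder_neqE)
  then have "countable (UNIV :: 'a set)"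
    by (rule countableI)
  with big show False by (simp add: big_ordinal_type_def)
qed

lemma common_bound: "\<exists>c. infinite {..<c} \<and> small c x \<and> small c y"
proof -
  obtain c :: 'a where c: "infinite {..<c}" using infinite_segment by blast
  define d where "d = max c (max x y)"
  have "{..<c} \<subseteq> {..<d}" "{..<x} \<subseteq> {..<d}" "{..<y} \<subseteq> {..<d}"
    by (auto simp: d_def le_max_iff_disj)
  then show ?thesis using c unfolding small_def
    by (meson finite_subset subset_imp_lepoll)
qed

text \<open>At most |c| segments, each of size at most |c|, have a union of size at most |c|, since
  \<open>c\<close> is infinite. The type is strictly larger, so some element escapes the union and
  bounds \<open>S\<close>. The least strict bound has its segment inside the union and is therefore
  small again.\<close>

lemma small_strict_bound:
  assumes c: "infinite {..<c}" and S: "S \<lesssim> {..<c}" and small: "\<And>s. s \<in> S \<Longrightarrow> small c s"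
  shows "\<exists>w. (\<forall>s\<in>S. s < w) \<and> small c w"
proof -
  have atMost: "{..s} \<lesssim> {..<c}" if "s \<in> S" for s
  proof -
    have "{..s} = insert s {..<s}" by auto
    moreover have "insert s {..<s} \<lesssim> insert c {..<c}"
      using small[OF that] by (auto simp: small_def insert_lepoll_insert_iff)
    moreover have "insert c {..<c} \<lesssim> {..<c}"
      using c by (simp add: eqpoll_imp_lepoll infinite_insert_eqpoll)
    ultimately show ?thesis using lepoll_trans by metis
  qed
  have T: "(\<Union>s\<in>S. {..s}) \<lesssim> {..<c}"
    using card_of_UNION_ordLeq_infinite[OF c, of S "\<lambda>s. {..s}"] S atMost
    unfolding lepoll_def card_of_ordLeq by blast
  moreover have "{..<c} \<prec> (UNIV :: 'a set)"
    using big by (simp add: big_ordinal_type_def)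
  ultimately have "(\<Union>s\<in>S. {..s}) \<noteq> UNIV"
    by (metis lesspoll_def lepoll_antisym)
  then obtain v where "v \<notin> (\<Union>s\<in>S. {..s})" by blast
  then have v: "\<forall>s\<in>S. s < v" by (auto simp: not_le)
  define w where "w = (LEAST w. \<forall>s\<in>S. s < w)"
  have w: "\<forall>s\<in>S. s < w"
    unfolding w_def using v by (rule LeastI)
  have "{..<w} \<subseteq> (\<Union>s\<in>S. {..s})"
    using not_less_Least[of _ "\<lambda>w. \<forall>s\<in>S. s < w"] by (auto simp: w_def not_less)
  then have "small c w"
    unfolding small_def using T lepoll_trans subset_imp_lepoll by blast
  with w show ?thesis by blast
qed

lemma small_mono: "small c x \<Longrightarrow> y \<le> x \<Longrightarrow> small c y"
  unfolding small_def by (meson lepoll_trans lessThan_subset_iff subset_imp_lepoll)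

text \<open>A bound for \<open>S\<close> exists by the previous lemma, so the \<open>LEAST\<close>
  in \<open>osup\<close> picks a genuine supremum. Smallness of the result lets the recursions
  continue.\<close>

lemma
  assumes "infinite {..<c}" "S \<lesssim> {..<c}" "\<And>s. s \<in> S \<Longrightarrow> small c s"
  shows small_osup: "small c (osup S)"
    and less_osup_iff: "w < osup S \<longleftrightarrow> (\<exists>s\<in>S. w < s)"
proof -
  obtain v where v: "\<forall>s\<in>S. s < v" "small c v"
    using small_strict_bound[OF assms] by blast
  have "osup S \<le> v" by (rule osup_le) (use v in auto)
  then show "small c (osup S)" using v small_mono by blast
  show "w < osup S \<longleftrightarrow> (\<exists>s\<in>S. w < s)"
    using osup_le[of S w] osup_upper[of S v] v by (meson less_imp_le not_le order.strict_trans2)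
qed

section \<open>Successors and limits\<close>

lemma less_osucc [simp]: "(x::'a) < osucc x"
  and small_osucc: "infinite {..<c} \<Longrightarrow> small c x \<Longrightarrow> small c (osucc x)"
proof -
  have *: "\<exists>w>x. small c w" if c: "infinite {..<c}" "small c x" for c
  proof -
    have "{x} \<lesssim> {..<c}"
      using c(1) by (metis finite.emptyI insert_absorb all_not_in_conv singleton_lepoll)
    then show ?thesis using small_strict_bound[of c "{x}"] c by auto
  qed
  show 1: "x < osucc x"
    unfolding osucc_def using common_bound[of x x] * by (metis LeastI)
  show "small c (osucc x)" if "infinite {..<c}" "small c x"
    using *[OF that] small_mono unfolding osucc_def by (meson Least_le)
qed

lemma less_osucc_iff [simp]: "y < osucc x \<longleftrightarrow> y \<le> (x::'a)"
  using not_less_Least[of y "\<lambda>y. x < y"] less_osucc[of x] unfolding osucc_def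
  by (meson leI le_less_trans)

lemma osucc_le_iff [simp]: "osucc x \<le> y \<longleftrightarrow> (x::'a) < y"
  by (meson less_osucc_iff not_less)

lemma osucc_inject [simp]: "osucc x = osucc y \<longleftrightarrow> x = (y::'a)"
  by (metis less_osucc less_osucc_iff order.antisym)

lemma osucc_neq_ozero [simp]: "osucc (x::'a) \<noteq> ozero"
  by (metis less_osucc not_less_ozero)

lemma not_olimit_osucc [simp]: "\<not> olimit (osucc (x::'a))"
  by (auto simp: olimit_def)

lemma opred_osucc [simp]: "opred (osucc x) = (x::'a)"
  by (simp add: opred_def)

lemma ord_cases [case_names zero succ limit]:
  obtains "y = \<zero>" | z where "y = osucc z" | "olimit y"
  by (metis olimit_def less_osucc_iff osucc_le_iff order.antisym not_le)

section \<open>Ordinal addition\<close>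

lemma oadd_zero [simp]: "x \<oplus> \<zero> = x"
  unfolding oadd_def by (subst wfrec[OF wf_ord_rel]) simp

lemma oadd_osucc [simp]: "x \<oplus> osucc y = osucc (x \<oplus> y)"
  unfolding oadd_def by (subst wfrec[OF wf_ord_rel]) simp

lemma oadd_limit: "olimit y \<Longrightarrow> x \<oplus> y = osup ((\<oplus>) x ` {..<y})"
  unfolding oadd_def by (subst wfrec[OF wf_ord_rel]) (simp add: olimit_def)

lemma small_image: "small c y \<Longrightarrow> f ` {..<y} \<lesssim> {..<c}"
  unfolding small_def using image_lepoll lepoll_trans by blast

lemma small_oadd:
  assumes "infinite {..<c}" "small c x" "small c y"
  shows "small c (x \<oplus> y)"
  using assms(3)
proof (induction y rule: less_induct)
  case (less y)
  show ?case
  proof (cases y rule: ord_cases)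
    case (succ z)
    then show ?thesis using less small_osucc[OF assms(1)] small_mono by (simp add: less_imp_le)
  next
    case limit
    then show ?thesis unfolding oadd_limit[OF limit]
      using less small_mono small_image by (intro small_osup[OF assms(1)]) (auto simp: less_imp_le)
  qed (use assms in simp)
qed

lemma less_oadd_limit_iff:
  assumes "olimit y"
  shows "w < x \<oplus> y \<longleftrightarrow> (\<exists>z<y. w < x \<oplus> z)"
proof -
  obtain c where c: "infinite {..<c}" "small c x" "small c y" using common_bound by blast
  have "w < osup ((\<oplus>) x ` {..<y}) \<longleftrightarrow> (\<exists>s\<in>(\<oplus>) x ` {..<y}. w < s)"
    using c small_mono by (intro less_osup_iff[OF c(1)] small_image) (auto intro!: small_oadd less_imp_le)
  then show ?thesis using oadd_limit[OF assms] by auto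
qed

text \<open>This lists the predecessors of a sum without distinguishing successors from limits. Two
  ordinals with the same predecessors are equal, so cancellation, associativity and monotonicity
  follow from it instead of from the recursion equations.\<close>

lemma less_oadd_iff: "w < x \<oplus> y \<longleftrightarrow> w < x \<or> (\<exists>z<y. w = x \<oplus> z)"
proof (induction y arbitrary: w rule: less_induct)
  case (less y)
  show ?case
  proof (cases y rule: ord_cases)
    case (succ z)
    then show ?thesis using less[of z w] by (auto simp: le_less)
  next
    case limit
    then have "\<zero> < y" "\<And>z. z < y \<Longrightarrow> osucc z < y" by (auto simp: olimit_def ozero_less_iff)
    then have "w < x \<oplus> y" if "w < x \<or> (\<exists>z<y. w = x \<oplus> z)"
      using that unfolding less_oadd_limit_iff[OF limit] by (metis less_osucc oadd_osucc oadd_zero)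
    moreover have "w < x \<or> (\<exists>z<y. w = x \<oplus> z)" if w: "w < x \<oplus> y"
    proof -
      obtain z where z: "z < y" "w < x \<oplus> z" using w less_oadd_limit_iff[OF limit] by blast
      then have "w < x \<or> (\<exists>z'<z. w = x \<oplus> z')" using less by blast
      then show ?thesis using z by (auto intro: order.strict_trans)
    qed
    ultimately show ?thesis by blast
  qed simp
qed

lemma oadd_strict_mono: "strict_mono ((\<oplus>) x)"
  unfolding strict_mono_def using less_oadd_iff by blast

lemma oadd_less_cancel [simp]: "x \<oplus> y < x \<oplus> z \<longleftrightarrow> y < z"
  by (rule strict_mono_less[OF oadd_strict_mono])

lemma oadd_le_cancel [simp]: "x \<oplus> y \<le> x \<oplus> z \<longleftrightarrow> y \<le> z"
  by (rule strict_mono_less_eq[OF oadd_strict_mono])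

lemma oadd_cancel [simp]: "x \<oplus> y = x \<oplus> z \<longleftrightarrow> y = z"
  by (rule strict_mono_eq[OF oadd_strict_mono])

lemma le_oadd_left [simp]: "x \<le> x \<oplus> y"
  by (metis oadd_le_cancel oadd_zero ozero_le)

lemma less_oadd_left [simp]: "x < x \<oplus> y \<longleftrightarrow> y \<noteq> \<zero>"
  by (metis oadd_less_cancel oadd_zero ozero_less_iff)

lemma oadd_eq_left_iff [simp]: "x \<oplus> y = x \<longleftrightarrow> y = \<zero>" "x = x \<oplus> y \<longleftrightarrow> y = \<zero>"
  by (metis oadd_cancel oadd_zero)+

lemma oadd_le_left_iff [simp]: "x \<oplus> y \<le> x \<longleftrightarrow> y = \<zero>"
  by (metis less_oadd_left not_le)

lemma zero_oadd [simp]: "\<zero> \<oplus> y = y"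
proof (induction y rule: less_induct)
  case (less y)
  then have "w < \<zero> \<oplus> y \<longleftrightarrow> w < y" for w using less_oadd_iff[of w \<zero> y] by auto
  then show ?case by (metis linorder_neqE less_irrefl)
qed

lemma oadd_eq_zero_iff [simp]: "x \<oplus> y = \<zero> \<longleftrightarrow> x = \<zero> \<and> y = \<zero>"
  by (metis le_oadd_left le_ozero_iff zero_oadd)

lemma oadd_assoc: "x \<oplus> y \<oplus> z = x \<oplus> (y \<oplus> z)"
proof (induction z rule: less_induct)
  case (less z)
  then have "w < x \<oplus> y \<oplus> z \<longleftrightarrow> w < x \<oplus> (y \<oplus> z)" for w
    by (auto simp: less_oadd_iff)
  then show ?case by (metis linorder_neqE less_irrefl)
qed

lemma oadd_mono_left: "x \<le> x' \<Longrightarrow> x \<oplus> y \<le> x' \<oplus> y"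
proof (induction y rule: less_induct)
  case (less y)
  have "w < x' \<oplus> y" if "w < x \<oplus> y" for w
    using that less by (metis le_oadd_left less_oadd_iff oadd_less_cancel order.strict_trans1 order.strict_trans2)
  then show ?case by (meson not_le less_irrefl)
qed

lemma oadd_mono: "x \<le> x' \<Longrightarrow> y \<le> y' \<Longrightarrow> x \<oplus> y \<le> x' \<oplus> y'"
  by (meson oadd_le_cancel oadd_mono_left order.trans)

lemma le_oadd_right [simp]: "y \<le> x \<oplus> y"
  by (metis oadd_mono_left ozero_le zero_oadd)

lemma le_iff_oadd: "x \<le> y \<longleftrightarrow> (\<exists>z. y = x \<oplus> z)"
  by (metis le_oadd_left le_oadd_right less_oadd_iff less_osucc not_le oadd_osucc osucc_le_iff)

section \<open>Finite multiples and the first limit\<close>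

lemma mult_less_Suc [simp]: "x \<odot> n < x \<odot> Suc n \<longleftrightarrow> x \<noteq> \<zero>"
  by simp

lemma mult_one [simp]: "x \<odot> Suc 0 = x" by simp

lemma mult_add: "x \<odot> (m + n) = x \<odot> m \<oplus> x \<odot> n"
  by (induction n) (simp_all add: oadd_assoc)

lemma mult_Suc_left: "x \<odot> Suc n = x \<oplus> x \<odot> n"
  using mult_add[of x 1 n] by simp

lemma mult_mono: "x \<le> y \<Longrightarrow> m \<le> n \<Longrightarrow> x \<odot> m \<le> y \<odot> n"
proof -
  assume "x \<le> y" "m \<le> n"
  have "x \<odot> m \<le> y \<odot> m" using \<open>x \<le> y\<close> by (induction m) (auto intro: oadd_mono)
  also have "\<dots> \<le> y \<odot> n" using mult_add[of y m "n - m"] \<open>m \<le> n\<close> by simp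
  finally show ?thesis .
qed

definition fin :: "nat \<Rightarrow> 'a" where "fin n = (osucc ^^ n) \<zero>"

lemma fin_simps [simp]: "fin 0 = \<zero>" "fin (Suc n) = osucc (fin n)"
  by (simp_all add: fin_def)

text \<open>Descending from \<open>y\<close> passes only through successors and ends at zero. The
  lemma serves twice: it identifies the segment below \<open>oomega\<close>, and it shows that a
  type without limits would be countable.\<close>

lemma range_fin_if_no_limit: "(\<And>x. x \<le> w \<Longrightarrow> \<not> olimit x) \<Longrightarrow> y \<le> w \<Longrightarrow> y \<in> range fin"
proof (induction y rule: less_induct)
  case (less y)
  show ?case
  proof (cases y rule: ord_cases)
    case zero then show ?thesis by (metis fin_simps(1) rangeI)
  next
    case (succ z)
    then have "z < y" by simp
    then have "z \<in> range fin" using less by (meson less_imp_le order.trans)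
    then show ?thesis using succ fin_simps(2) by (metis (no_types, lifting) image_iff rangeI)
  next
    case limit then show ?thesis using less by blast
  qed
qed

lemma olimit_oomega: "olimit (oomega :: 'a)"
proof -
  have "\<exists>x::'a. olimit x"
  proof (rule ccontr)
    assume "\<nexists>x::'a. olimit x"
    then have "UNIV \<subseteq> range fin" using range_fin_if_no_limit by blast
    then have "countable (UNIV :: 'a set)" by (meson countable_image countable_subset countableI_type)
    with big show False by (simp add: big_ordinal_type_def)
  qed
  then show ?thesis unfolding oomega_def by (metis LeastI)
qed

lemma below_oomega: "{..<oomega} = range fin"
proof
  have "y \<in> range fin" if "y < oomega" for y
    using that not_less_Least[of _ olimit] unfolding oomega_def
    by (intro range_fin_if_no_limit[of y y]) (use order.strict_trans1 in blast)+
  then show "{..<oomega} \<subseteq> range fin" by auto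
  have "fin n < oomega" for n
    using olimit_oomega by (induction n) (auto simp: olimit_def ozero_less_iff)
  then show "range fin \<subseteq> {..<oomega}" by auto
qed

lemma omul_fin: "omul x (fin n) = x \<odot> n"
proof (induction n)
  case 0
  show ?case unfolding omul_def by (subst wfrec[OF wf_ord_rel]) simp
next
  case (Suc n)
  show ?case using Suc unfolding omul_def by (subst wfrec[OF wf_ord_rel]) simp
qed

lemma omul_oomega: "omul x oomega = osup (range ((\<odot>) x))"
proof -
  have "omul x oomega = osup (omul x ` {..<oomega})"
    using olimit_oomega unfolding omul_def by (subst wfrec[OF wf_ord_rel]) (simp add: olimit_def)
  also have "omul x ` {..<oomega} = range ((\<odot>) x)"
    by (simp add: below_oomega omul_fin image_image)
  finally show ?thesis .
qed

section \<open>Exponentiation with base \<omega>\<close>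

lemma oexp_zero: "\<omega> \<zero> = osucc \<zero>"
  unfolding oexp_def by (subst wfrec[OF wf_ord_rel]) simp

lemma oexp_osucc: "\<omega> (osucc y) = osup (range ((\<odot>) (\<omega> y)))"
proof -
  have "\<omega> (osucc y) = omul (\<omega> y) oomega"
    unfolding oexp_def by (subst wfrec[OF wf_ord_rel]) simp
  then show ?thesis by (simp add: omul_oomega)
qed

lemma oexp_limit: "olimit y \<Longrightarrow> \<omega> y = osup (\<omega> ` {..<y})"
  unfolding oexp_def by (subst wfrec[OF wf_ord_rel]) (simp add: olimit_def)

lemma small_zero: "infinite {..<c} \<Longrightarrow> small c \<zero>"
  by (simp add: small_def lessThan_def)

lemma small_mult: "infinite {..<c} \<Longrightarrow> small c x \<Longrightarrow> small c (x \<odot> n)"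
  by (induction n) (auto intro: small_zero small_oadd)

lemma range_nat_lepoll: "infinite {..<c} \<Longrightarrow> range (f :: nat \<Rightarrow> 'a) \<lesssim> {..<c}"
  by (meson image_lepoll infinite_le_lepoll lepoll_trans)

lemma small_oexp:
  assumes "infinite {..<c}" "small c y"
  shows "small c (\<omega> y)"
  using assms(2)
proof (induction y rule: less_induct)
  case (less y)
  show ?case
  proof (cases y rule: ord_cases)
    case zero
    then show ?thesis using assms by (simp add: oexp_zero small_osucc small_zero)
  next
    case (succ z)
    then have "small c (\<omega> z)" using less small_mono by (simp add: less_imp_le)
    then show ?thesis unfolding succ oexp_osucc
      using assms by (intro small_osup[OF assms(1)] range_nat_lepoll) (auto intro: small_mult simp del: ntimes.simps)
  next
    case limit
    then show ?thesis unfolding oexp_limit[OF limit]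
      using less small_mono small_image by (intro small_osup[OF assms(1)]) (auto simp: less_imp_le)
  qed
qed

lemma less_oexp_osucc_iff: "w < \<omega> (osucc y) \<longleftrightarrow> (\<exists>n. w < \<omega> y \<odot> n)"
proof -
  obtain c where c: "infinite {..<c}" "small c y" using common_bound by blast
  have "w < osup (range ((\<odot>) (\<omega> y))) \<longleftrightarrow> (\<exists>s\<in>range ((\<odot>) (\<omega> y)). w < s)"
    using c by (intro less_osup_iff[OF c(1)] range_nat_lepoll) (auto intro!: small_mult small_oexp)
  then show ?thesis by (auto simp: oexp_osucc)
qed

lemma less_oexp_limit_iff: "olimit y \<Longrightarrow> w < \<omega> y \<longleftrightarrow> (\<exists>z<y. w < \<omega> z)"
proof -
  assume y: "olimit y"
  obtain c where c: "infinite {..<c}" "small c y" using common_bound by blast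
  have "w < osup (\<omega> ` {..<y}) \<longleftrightarrow> (\<exists>s\<in>\<omega> ` {..<y}. w < s)"
    using c small_mono by (intro less_osup_iff[OF c(1)] small_image) (auto intro!: small_oexp less_imp_le)
  then show ?thesis using oexp_limit[OF y] by auto
qed

lemma oexp_neq_zero [simp]: "\<omega> y \<noteq> \<zero>"
proof (induction y rule: less_induct)
  case (less y)
  show ?case
  proof (cases y rule: ord_cases)
    case zero then show ?thesis by (simp add: oexp_zero)
  next
    case (succ z)
    then have "\<zero> < \<omega> z \<odot> 1" using less by (simp add: ozero_less_iff)
    then show ?thesis using less_oexp_osucc_iff succ ozero_less_iff by blast
  next
    case limit
    then have "\<zero> < y" by (simp add: olimit_def ozero_less_iff)
    then show ?thesis using less_oexp_limit_iff[OF limit] less by (metis ozero_less_iff)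
  qed
qed

lemma oexp_strict_mono: "z < y \<Longrightarrow> \<omega> z < \<omega> y"
proof (induction y rule: less_induct)
  case (less y)
  have succ_step: "\<omega> x < \<omega> (osucc x)" for x
    using less_oexp_osucc_iff[of "\<omega> x" x] mult_less_Suc[of "\<omega> x" 1] by (metis One_nat_def mult_one oexp_neq_zero)
  show ?case
  proof (cases y rule: ord_cases)
    case zero then show ?thesis using less by simp
  next
    case (succ x)
    then show ?thesis using less succ_step[of x]
      by (metis le_less less_osucc less_osucc_iff order.strict_trans)
  next
    case limit
    then have "osucc z < y" using less by (simp add: olimit_def)
    then show ?thesis using less_oexp_limit_iff[OF limit] succ_step by blast
  qed
qed

lemma oexp_less_iff [simp]: "\<omega> x < \<omega> y \<longleftrightarrow> x < y"
  by (rule strict_mono_less) (simp add: strict_mono_def oexp_strict_mono)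

lemma oexp_le_iff [simp]: "\<omega> x \<le> \<omega> y \<longleftrightarrow> x \<le> y"
  by (rule strict_mono_less_eq) (simp add: strict_mono_def oexp_strict_mono)

lemma oexp_eq_iff [simp]: "\<omega> x = \<omega> y \<longleftrightarrow> x = y"
  by (rule strict_mono_eq) (simp add: strict_mono_def oexp_strict_mono)

text \<open>One criterion covers zero, successor and limit exponents, so later arguments on powers
  need no case distinction on the exponent.\<close>

lemma less_oexp_iff: "w < \<omega> y \<longleftrightarrow> w = \<zero> \<or> (\<exists>z<y. \<exists>n. w < \<omega> z \<odot> n)"
proof (cases y rule: ord_cases)
  case zero
  then show ?thesis by (simp add: oexp_zero)
next
  case (succ x)
  have "\<omega> z \<odot> n \<le> \<omega> x \<odot> n" if "z < y" for z n
    using that succ by (intro mult_mono) auto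
  then show ?thesis
    using succ less_oexp_osucc_iff[of w x] ozero_less_iff[of "\<omega> y"] by (metis less_osucc oexp_neq_zero order.strict_trans2)
next
  case limit
  have "w < \<omega> z \<Longrightarrow> w < \<omega> z \<odot> 1" for z by simp
  moreover have "\<omega> z \<odot> n < \<omega> y" if "z < y" for z n
  proof -
    have "\<omega> z \<odot> n \<le> \<omega> (osucc z)"
      using less_oexp_osucc_iff[of "\<omega> z \<odot> n" z] mult_less_Suc oexp_neq_zero less_imp_le by blast
    moreover have "osucc z < y" using that limit by (simp add: olimit_def)
    ultimately show ?thesis using oexp_less_iff order.strict_trans1 by blast
  qed
  ultimately show ?thesis unfolding less_oexp_limit_iff[OF limit]
    by (metis less_oexp_limit_iff limit order.strict_trans oexp_neq_zero ozero_less_iff)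
qed

lemma le_oexp [simp]: "y \<le> \<omega> y"
proof (induction y rule: less_induct)
  case (less y)
  have "z < \<omega> y" if "z < y" for z
    using less[OF that] oexp_less_iff that order.strict_trans1 by blast
  then show ?case by (meson not_le less_irrefl)
qed

text \<open>Both summands lie below finite multiples of a common smaller power, and the sum of two
  such multiples is again a finite multiple.\<close>

lemma oadd_less_oexp: "a < \<omega> y \<Longrightarrow> b < \<omega> y \<Longrightarrow> a \<oplus> b < \<omega> y"
proof (cases "a = \<zero> \<or> b = \<zero>")
  case False
  assume "a < \<omega> y" "b < \<omega> y"
  with False obtain z n z' m where z: "z < y" "a < \<omega> z \<odot> n" "z' < y" "b < \<omega> z' \<odot> m"
    by (auto simp: less_oexp_iff)
  define v where "v = max z z'"
  have v: "v < y" "\<omega> z \<le> \<omega> v" "\<omega> z' \<le> \<omega> v" using z by (auto simp: v_def)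
  have "a \<oplus> b < a \<oplus> \<omega> v \<odot> m"
    using z(4) mult_mono[OF v(3) order.refl, of m] by (auto intro: order.strict_trans2)
  also have "\<dots> \<le> \<omega> v \<odot> n \<oplus> \<omega> v \<odot> m"
    using z(2) mult_mono[OF v(2) order.refl, of n] by (auto intro: oadd_mono less_imp_le order.strict_trans2)
  finally show ?thesis using v(1) unfolding less_oexp_iff mult_add[symmetric] by blast
qed auto

lemma oadd_oexp_absorb: "a < \<omega> y \<Longrightarrow> a \<oplus> \<omega> y = \<omega> y"
proof (rule ccontr)
  assume a: "a < \<omega> y" "a \<oplus> \<omega> y \<noteq> \<omega> y"
  then have "\<omega> y < a \<oplus> \<omega> y" by (metis le_less le_oadd_right)
  then show False unfolding less_oadd_iff using a oadd_less_oexp by (metis less_asym less_irrefl)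
qed

lemma mult_less_oexp: "a < \<omega> y \<Longrightarrow> a \<odot> n < \<omega> y"
  by (induction n) (auto simp: oadd_less_oexp ozero_less_iff)

text \<open>Iterating \<open>a \<oplus> u = u\<close> shows that \<open>u\<close> absorbs, hence
  exceeds or equals, every finite multiple of \<open>a\<close>. Below, this handles the trailing
  exponent zero, for which \<open>lt1\<close> carries no information.\<close>

lemma oexp_osucc_le_if_absorbed:
  assumes "\<omega> c \<le> a" "a \<oplus> u = u"
  shows "\<omega> (osucc c) \<le> u"
proof -
  have absorb: "a \<odot> n \<oplus> u = u" for n
    by (induction n) (simp_all add: oadd_assoc assms)
  have "w < u" if w: "w < \<omega> (osucc c)" for w
  proof -
    obtain n where "w < \<omega> c \<odot> n" using w less_oexp_osucc_iff by blast
    also have "\<dots> \<le> a \<odot> n" using assms by (intro mult_mono) auto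
    also have "\<dots> \<le> u" using absorb[of n] le_oadd_left by metis
    finally show ?thesis .
  qed
  then show ?thesis by (meson not_le less_irrefl)
qed

text \<open>Take the least power above \<open>x\<close>. Some smaller power has a multiple above
  \<open>x\<close>, and by leastness that power is itself at most \<open>x\<close>. A remainder
  equal to \<open>x\<close> would mean absorption and would push \<open>x\<close> up to the next
  power.\<close>

lemma leading_term:
  assumes "x \<noteq> \<zero>"
  obtains a r where "x = \<omega> a \<oplus> r" "r < x" "x < \<omega> (osucc a)"
proof -
  define c where "c = (LEAST c. x < \<omega> c)"
  have "x < \<omega> (osucc x)" by (meson le_oexp less_osucc order.strict_trans2)
  then have c: "x < \<omega> c" unfolding c_def by (rule LeastI)
  have least: "\<omega> z \<le> x" if "z < c" for z
    using not_less_Least[of z "\<lambda>c. x < \<omega> c"] that by (simp add: c_def)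
  obtain z n where z: "z < c" "x < \<omega> z \<odot> n" using c assms less_oexp_iff by blast
  then have x: "x < \<omega> (osucc z)" using less_oexp_osucc_iff by blast
  obtain r where r: "x = \<omega> z \<oplus> r" using least[OF z(1)] le_iff_oadd by blast
  have "r \<le> x" using r le_oadd_right by metis
  moreover have "r \<noteq> x" using oexp_osucc_le_if_absorbed[of z "\<omega> z" x] r x by fastforce
  ultimately have "r < x" by simp
  with r x that show ?thesis by blast
qed

section \<open>Principal elements and the relation \<open><\<^sub>1\<close>\<close>

text \<open>A finite subset of a limit is already bounded below it, so it can be reflected by means
  of some earlier \<open>y\<close>. The contrapositive is what counts later: if \<open>a\<close> is
  not connected to the limit, the failure shows up below the limit.\<close>

lemma lt1_limit:
  assumes x: "olimit x" "a < x" and below: "\<And>y. a < y \<Longrightarrow> y < x \<Longrightarrow> a \<lhd> y"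
  shows "a \<lhd> x"
proof (rule lt1I)
  fix B assume B: "finite B" "B \<subseteq> {..<x}"
  define y where "y = Max (osucc ` insert a B)"
  have "y \<in> osucc ` insert a B" unfolding y_def using B by (intro Max_in) auto
  then have "y < x" using x B by (auto simp: olimit_def)
  have le: "osucc z \<le> y" if "z \<in> insert a B" for z
    unfolding y_def using B that by (intro Max_ge) auto
  then have "a < y" "B \<subseteq> {..<y}" by auto
  then show "\<exists>h. iso_plus lt1 B h \<and> h ` B \<subseteq> {..<a} \<and> (\<forall>x\<in>B. x < a \<longrightarrow> h x = x)"
    using lt1E[OF below[of y]] \<open>y < x\<close> B(1) by metis
qed (rule x)

lemma olimit_oexp:
  assumes "z \<noteq> \<zero>"
  shows "olimit (\<omega> z)"
proof -
  have "\<omega> \<zero> < \<omega> z" using assms by (simp add: ozero_less_iff)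
  then have "y \<oplus> \<omega> \<zero> < \<omega> z" if "y < \<omega> z" for y
    using that by (rule oadd_less_oexp[rotated])
  then show ?thesis by (simp add: olimit_def oexp_zero)
qed

lemma trailing_term:
  assumes "z \<noteq> \<zero>"
  obtains z' v where "z = z' \<oplus> \<omega> v"
proof -
  have "\<exists>z' v. z = z' \<oplus> \<omega> v"
    using assms
  proof (induction z rule: less_induct)
    case (less z)
    obtain a r where r: "z = \<omega> a \<oplus> r" "r < z" using leading_term[OF less.prems] .
    show ?case
    proof (cases "r = \<zero>")
      case True
      then show ?thesis using r zero_oadd by (metis oadd_zero)
    next
      case False
      then obtain z' v where "r = z' \<oplus> \<omega> v" using less.IH r(2) by blast
      then show ?thesis using r(1) oadd_assoc by metis
    qed
  qed
  with that show ?thesis by blast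
qed

text \<open>If \<open>a\<close> exceeds \<open>q\<close>, the excess is below
  \<open>\<omega> w\<close> and is absorbed by it. This turns a strict bound \<open>a\<close> on an
  exponent into one that includes the trailing power.\<close>

lemma oadd_trailing_le:
  assumes "a < q \<oplus> \<omega> w"
  shows "a \<oplus> \<omega> w \<le> q \<oplus> \<omega> w"
proof (cases "a \<le> q")
  case True
  then show ?thesis by (rule oadd_mono_left)
next
  case False
  then obtain c where "c < \<omega> w" "a = q \<oplus> c" using assms unfolding less_oadd_iff by auto
  then show ?thesis by (simp add: oadd_assoc oadd_oexp_absorb)
qed

text \<open>Suppose \<open>a = \<omega> y \<oplus> r\<close> with both summands below
  \<open>a\<close>. A reflection fixes the summands, hence their sum \<open>a\<close>, although the
  image must lie below \<open>a\<close>. So \<open>a\<close> is a power. It is not 1, because two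
  points do not fit below 1; hence its exponent has a trailing term.\<close>

lemma lt1_imp_oexp:
  assumes "a \<lhd> b"
  obtains z v where "a = \<omega> (z \<oplus> \<omega> v)"
proof -
  have succ: "a \<lhd> osucc a" using lt1_downward[OF assms, of "osucc a"] lt1_less[OF assms] by simp
  have fixed: "\<exists>h. iso_plus lt1 B h \<and> h ` B \<subseteq> {..<a} \<and> (\<forall>x\<in>B. x < a \<longrightarrow> h x = x)"
    if "finite B" "B \<subseteq> {..a}" for B
  proof -
    have "B \<subseteq> {..<osucc a}" using that by auto
    then show ?thesis using lt1E[OF succ that(1)] by metis
  qed
  have "a \<noteq> \<zero>" using fixed[of "{\<zero>}"] by auto
  then obtain y r where r: "a = \<omega> y \<oplus> r" "r < a" using leading_term by blast
  have "r = \<zero>"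
  proof (rule ccontr)
    assume "r \<noteq> \<zero>"
    then have y: "\<omega> y < a" using r(1) by simp
    obtain h where h: "iso_plus lt1 {\<omega> y, r, a} h" "h ` {\<omega> y, r, a} \<subseteq> {..<a}"
        "\<forall>x\<in>{\<omega> y, r, a}. x < a \<longrightarrow> h x = x"
      using fixed[of "{\<omega> y, r, a}"] y r(2) by (auto simp: less_imp_le)
    have "h (\<omega> y) \<oplus> h r = h a" using iso_plusD(3)[OF h(1), of "\<omega> y" r a] r(1) by simp
    then have "h a = a" using h(3) y r by simp
    then show False using h(2) by simp
  qed
  then have a: "a = \<omega> y" using r by simp
  have "y \<noteq> \<zero>"
  proof
    assume "y = \<zero>"
    then have a1: "a = osucc \<zero>" using a by (simp add: oexp_zero)
    obtain h where h: "iso_plus lt1 {\<zero>, a} h" "h ` {\<zero>, a} \<subseteq> {..<a}"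
      using fixed[of "{\<zero>, a}"] by auto
    have "h \<zero> < h a" using iso_plusD(1)[OF h(1), of \<zero> a] a1 by simp
    then show False using h(2) a1 by simp
  qed
  then show ?thesis using trailing_term a that by metis
qed

text \<open>Such a sum lies strictly between a power and the next one, so it is not a power. Among
  the points \<open>x \<oplus> \<eta>\<close> with \<open>\<eta> < x\<close> and \<open>x\<close> a
  power, only \<open>x\<close> itself can therefore start a \<open>lt1\<close> pair.\<close>

lemma not_lt1_oexp_oadd:
  assumes "r \<noteq> \<zero>" "r < \<omega> z"
  shows "\<not> \<omega> z \<oplus> r \<lhd> b"
proof
  assume "\<omega> z \<oplus> r \<lhd> b"
  then obtain y where y: "\<omega> z \<oplus> r = \<omega> y" using lt1_imp_oexp by metis
  then have zy: "\<omega> z < \<omega> y" using assms(1) by (metis less_oadd_left)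
  then have "\<omega> z \<oplus> r < \<omega> y" using assms(2) by (intro oadd_less_oexp) (auto elim: order.strict_trans)
  then show False using y by simp
qed

text \<open>Powers \<open>\<omega> (z \<oplus> \<omega> v)\<close> are approached from below by
  replacing the trailing \<open>\<omega> v\<close> with multiples of \<open>\<omega> v'\<close>,
  where \<open>v' < v\<close> may be taken as large as any given \<open>m\<close>. This supplies the
  targets of the reflections in \<open>le1_oexp_oadd\<close>.\<close>

lemma oexp_approximation:
  assumes c: "c < \<omega> (z \<oplus> \<omega> v)" and m: "m < v"
  obtains z' v' where "m \<le> v'" "v' < \<omega> (z' \<oplus> \<omega> v')" "c < \<omega> (z' \<oplus> \<omega> v')"
    "\<omega> (z' \<oplus> \<omega> v') < \<omega> (z \<oplus> \<omega> v)"
proof -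
  have "\<exists>u<v. \<exists>n. c < \<omega> (z \<oplus> \<omega> u \<odot> Suc n)"
  proof (cases "c = \<zero>")
    case True
    then show ?thesis using m by (auto simp: ozero_less_iff)
  next
    case False
    then obtain y k where y: "y < z \<oplus> \<omega> v" "c < \<omega> y \<odot> k" using c less_oexp_iff by blast
    then have suff: "c < \<omega> q" if "y < q" for q using that less_oexp_iff by blast
    show ?thesis
    proof (cases "y \<le> z")
      case True
      then have "y < z \<oplus> \<omega> m \<odot> Suc 0" by (metis less_oadd_left mult_one oexp_neq_zero order.strict_trans1)
      then show ?thesis using m suff by blast
    next
      case False
      then obtain w where w: "w < \<omega> v" "y = z \<oplus> w" "w \<noteq> \<zero>" using y(1) unfolding less_oadd_iff by auto
      then obtain u n where u: "u < v" "w < \<omega> u \<odot> n" using less_oexp_iff by blast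
      then have "w < \<omega> u \<odot> Suc n"
        using mult_mono[of "\<omega> u" "\<omega> u" n "Suc n"] order.strict_trans2 by (metis le_SucI order.refl)
      then have "y < z \<oplus> \<omega> u \<odot> Suc n" using w(2) by (simp del: ntimes.simps)
      then show ?thesis using u(1) suff by blast
    qed
  qed
  then obtain u n where u: "u < v" "c < \<omega> (z \<oplus> \<omega> u \<odot> Suc n)" by blast
  \<comment> \<open>Raising \<open>u\<close> to \<open>v'\<close> keeps \<open>c\<close> below the
    new power. Since \<open>z'\<close> already contains copies of \<open>\<omega> v'\<close>, adding
    one more makes the exponent exceed \<open>\<omega> v'\<close>, which gives
    \<open>v' < \<omega> (z' \<oplus> \<omega> v')\<close>.\<close>
  define v' where "v' = max m u"
  define z' where "z' = z \<oplus> \<omega> v' \<odot> Suc n"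
  have z': "z' \<oplus> \<omega> v' = z \<oplus> \<omega> v' \<odot> Suc (Suc n)"
    by (simp add: z'_def oadd_assoc)
  have "m \<le> v'" "v' < v" "u \<le> v'" using u(1) m by (auto simp: v'_def)
  have "\<omega> v' \<le> z'" unfolding z'_def ntimes.simps(2)
    by (meson le_oadd_right order.trans)
  then have "\<omega> v' < z' \<oplus> \<omega> v'" by (meson less_oadd_left oexp_neq_zero order.strict_trans1)
  then have 2: "v' < \<omega> (z' \<oplus> \<omega> v')"
    by (meson le_oexp order.strict_trans1 order.strict_trans2)
  have "z \<oplus> \<omega> u \<odot> Suc n \<le> z' \<oplus> \<omega> v'"
    unfolding z' using \<open>u \<le> v'\<close> by (intro oadd_mono mult_mono) auto
  then have 3: "c < \<omega> (z' \<oplus> \<omega> v')" using u(2) by (meson oexp_le_iff order.strict_trans2)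
  have "\<omega> v' \<odot> Suc (Suc n) < \<omega> v" using \<open>v' < v\<close> by (intro mult_less_oexp) simp
  then have 4: "\<omega> (z' \<oplus> \<omega> v') < \<omega> (z \<oplus> \<omega> v)"
    unfolding z' by (simp del: ntimes.simps)
  show ?thesis using that[OF \<open>m \<le> v'\<close> 2 3 4] .
qed

text \<open>The order and the sums among low points and shifted points depend only on the offsets,
  because \<open>x\<close> and \<open>x'\<close> absorb everything below them and offsets are below
  \<open>x'\<close>. For \<open>lt1\<close>, a positive offset never starts a pair, so only pairs
  starting at a low point or at the base need hypotheses.\<close>

lemma iso_plus_shift:
  assumes x: "x = \<omega> p" and x': "x' = \<omega> p'" and less: "x' < x"
    and N: "\<And>\<eta>. \<eta> \<in> N \<Longrightarrow> \<eta> < x'"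
    and cases: "\<And>y. y \<in> B \<Longrightarrow> y < x' \<and> h y = y \<or> (\<exists>\<eta>\<in>N. y = x \<oplus> \<eta> \<and> h y = x' \<oplus> \<eta>)"
    and lt1_low: "\<And>y \<eta>. y \<in> B \<Longrightarrow> y < x' \<Longrightarrow> \<eta> \<in> N \<Longrightarrow> y \<lhd> x \<oplus> \<eta> \<longleftrightarrow> y \<lhd> x' \<oplus> \<eta>"
    and lt1_high: "\<And>\<eta>. \<eta> \<in> N \<Longrightarrow> \<eta> \<noteq> \<zero> \<Longrightarrow> x \<lhd> x \<oplus> \<eta> \<and> x' \<lhd> x' \<oplus> \<eta>"
  shows "iso_plus lt1 B h"
proof -
  have low: "y < x" "y < x \<oplus> \<eta>" "y < x' \<oplus> \<eta>" "\<not> x \<oplus> \<eta> < y" "\<not> x' \<oplus> \<eta> < y" "y \<noteq> x \<oplus> \<eta>"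
      "y \<noteq> x' \<oplus> \<eta>" "x \<oplus> \<eta> \<noteq> y" "x' \<oplus> \<eta> \<noteq> y" "\<not> x \<oplus> \<eta> \<lhd> y" "\<not> x' \<oplus> \<eta> \<lhd> y"
    if "y < x'" for y \<eta>
  proof -
    show yx: "y < x" using that less by (rule order.strict_trans)
    show 1: "y < x \<oplus> \<eta>" using yx le_oadd_left by (rule order.strict_trans2)
    show 2: "y < x' \<oplus> \<eta>" using that le_oadd_left by (rule order.strict_trans2)
    show "\<not> x \<oplus> \<eta> < y" "\<not> x' \<oplus> \<eta> < y" "y \<noteq> x \<oplus> \<eta>"
      "y \<noteq> x' \<oplus> \<eta>" "x \<oplus> \<eta> \<noteq> y" "x' \<oplus> \<eta> \<noteq> y" using 1 2 by auto
    then show "\<not> x \<oplus> \<eta> \<lhd> y" "\<not> x' \<oplus> \<eta> \<lhd> y" using lt1_less by blast+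
  qed
  have N': "\<eta> < x" if "\<eta> \<in> N" for \<eta> using N[OF that] less by (rule order.strict_trans)
  have order: "(y < z \<longleftrightarrow> h y < h z) \<and> (y = z \<longleftrightarrow> h y = h z)" if "y \<in> B" "z \<in> B" for y z
    using cases[OF that(1)] cases[OF that(2)] by (elim disjE bexE conjE) (simp_all add: low)
  have high: "x \<oplus> \<eta> \<lhd> x \<oplus> \<eta>' \<longleftrightarrow> x' \<oplus> \<eta> \<lhd> x' \<oplus> \<eta>'" if "\<eta> \<in> N" "\<eta>' \<in> N" for \<eta> \<eta>'
  proof (cases "\<eta> = \<zero>")
    case True
    have "\<not> x \<lhd> x" "\<not> x' \<lhd> x'" using lt1_less by blast+
    then show ?thesis using True lt1_high[OF that(2)] by (cases "\<eta>' = \<zero>") auto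
  next
    case False
    then show ?thesis using not_lt1_oexp_oadd N[OF that(1)] N'[OF that(1)] unfolding x x' by blast
  qed
  have lt1: "y \<lhd> z \<longleftrightarrow> h y \<lhd> h z" if "y \<in> B" "z \<in> B" for y z
    using cases[OF that(1)] cases[OF that(2)]
    by (elim disjE bexE conjE) (simp_all add: low(10,11) high lt1_low[OF that(1)])
  have plus: "y \<oplus> z = w \<longleftrightarrow> h y \<oplus> h z = h w" if B: "y \<in> B" "z \<in> B" "w \<in> B" for y z w
  proof -
    have absorb: "y \<oplus> (x \<oplus> \<eta>) = x \<oplus> \<eta>" "y \<oplus> (x' \<oplus> \<eta>) = x' \<oplus> \<eta>" if "y < x'" for y \<eta>
      using oadd_oexp_absorb that low(1)[OF that] unfolding x x' oadd_assoc[symmetric] by simp_all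
    have sum: "y \<oplus> z < x'" if "y < x'" "z < x'" for y z
      using that unfolding x' by (rule oadd_less_oexp)
    have ge: "x \<oplus> \<eta> \<noteq> \<eta>'" "x' \<oplus> \<eta> \<noteq> \<eta>'" if "\<eta>' \<in> N" for \<eta> \<eta>'
      using low N[OF that] by blast+
    show ?thesis
      using cases[OF B(1)] cases[OF B(2)]
    proof (elim disjE bexE conjE)
      assume "y < x'" "h y = y" "z < x'" "h z = z"
      then show ?thesis using cases[OF B(3)] sum by (elim disjE bexE conjE) (simp_all add: low)
    next
      fix \<eta> assume "y < x'" "h y = y" "\<eta> \<in> N" "z = x \<oplus> \<eta>" "h z = x' \<oplus> \<eta>"
      then show ?thesis using cases[OF B(3)] by (elim disjE bexE conjE) (simp_all add: low absorb)
    next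
      fix \<eta> assume "z < x'" "h z = z" "\<eta> \<in> N" "y = x \<oplus> \<eta>" "h y = x' \<oplus> \<eta>"
      then show ?thesis using cases[OF B(3)] by (elim disjE bexE conjE) (simp_all add: low oadd_assoc)
    next
      fix \<eta> \<eta>' assume "\<eta> \<in> N" "y = x \<oplus> \<eta>" "h y = x' \<oplus> \<eta>" "\<eta>' \<in> N" "z = x \<oplus> \<eta>'" "h z = x' \<oplus> \<eta>'"
      then show ?thesis using cases[OF B(3)]
        by (elim disjE bexE conjE) (simp_all add: low oadd_assoc absorb N ge)
    qed
  qed
  show ?thesis unfolding iso_plus_def inj_on_def using order lt1 plus by simp
qed

text \<open>Induction on \<open>\<xi>\<close>, for all \<open>z\<close> and \<open>v\<close> at
  once. To reflect a finite set, the offsets stay unchanged and \<open>x\<close> moves to an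
  approximation \<open>x'\<close>. The induction hypothesis is applied both to \<open>x\<close> and
  to \<open>x'\<close>, whose trailing exponent \<open>v'\<close> still dominates all
  offsets.\<close>

lemma le1_oexp_oadd:
  assumes "\<xi> \<le> v"
  shows "\<omega> (z \<oplus> \<omega> v) \<unlhd> \<omega> (z \<oplus> \<omega> v) \<oplus> \<xi>"
  using assms
proof (induction \<xi> arbitrary: z v rule: less_induct)
  case (less \<xi>)
  define x where "x = \<omega> (z \<oplus> \<omega> v)"
  have lt1_IH: "\<omega> (z \<oplus> \<omega> v) \<lhd> \<omega> (z \<oplus> \<omega> v) \<oplus> \<eta>" if "\<eta> < \<xi>" "\<eta> \<le> v" "\<eta> \<noteq> \<zero>" for \<eta> z v
    using less.IH[OF that(1,2), of z] that(3) by (auto simp: le1_def)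
  have lim: "olimit x" unfolding x_def by (rule olimit_oexp) simp
  show ?case unfolding x_def[symmetric]
  proof (cases "\<xi> = \<zero>")
    case True
    then show "x \<unlhd> x \<oplus> \<xi>" by (simp add: le1_def)
  next
    case False
    have "\<exists>h. iso_plus lt1 B h \<and> h ` B \<subseteq> {..<x} \<and> (\<forall>y\<in>B. y < x \<longrightarrow> h y = y)"
      if B: "finite B" "B \<subseteq> {..<x \<oplus> \<xi>}" for B
    proof -
      define N where "N = {\<eta>. x \<oplus> \<eta> \<in> B}"
      have "inj ((\<oplus>) x)" by (simp add: inj_def)
      then have finN: "finite N"
        using finite_vimageI[OF B(1)] by (simp add: N_def vimage_def)
      have N: "\<eta> < \<xi>" if "\<eta> \<in> N" for \<eta> using that B(2) by (auto simp: N_def)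
      \<comment> \<open>Zero is inserted to allow \<open>N\<close> to be empty. Since
        \<open>m < v\<close>, there is room for a trailing exponent below \<open>v\<close> that is
        at least every offset.\<close>
      define m where "m = Max (insert \<zero> N)"
      have "m \<in> insert \<zero> N" unfolding m_def using finN by (intro Max_in) auto
      then have "m < \<xi>" using False N by (auto simp: ozero_less_iff)
      then have "m < v" using less.prems by (rule order.strict_trans2)
      have mN: "\<eta> \<le> m" if "\<eta> \<in> N" for \<eta>
        unfolding m_def using finN that by (intro Max_ge) auto
      \<comment> \<open>For \<open>b\<close> not connected to \<open>x\<close>, the value
        \<open>f b\<close> is a place below \<open>x\<close> where the failure is already visible.
        An \<open>x'\<close> above all these places satisfies \<open>b \<lhd> x'\<close> exactly
        when \<open>b \<lhd> x\<close>, for each \<open>b\<close> in \<open>B\<close> below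
        \<open>x\<close>.\<close>
      have "\<exists>y<x. b < y \<and> (\<not> b \<lhd> x \<longrightarrow> \<not> b \<lhd> y)" if "b < x" for b
      proof (cases "b \<lhd> x")
        case True
        then show ?thesis using lim that less_osucc unfolding olimit_def by blast
      next
        case False
        then show ?thesis using lt1_limit[OF lim that] by blast
      qed
      then obtain f where f: "\<And>b. b < x \<Longrightarrow> f b < x \<and> b < f b \<and> (\<not> b \<lhd> x \<longrightarrow> \<not> b \<lhd> f b)"
        by metis
      define c where "c = Max (insert \<zero> (f ` (B \<inter> {..<x})))"
      have "c \<in> insert \<zero> (f ` (B \<inter> {..<x}))" unfolding c_def using B by (intro Max_in) auto
      then have "c < x" using f lim by (auto simp: ozero_less_iff olimit_def)
      have c: "f b \<le> c" if "b \<in> B" "b < x" for b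
        unfolding c_def using B that by (intro Max_ge) auto
      obtain z' v' where v': "m \<le> v'" "v' < \<omega> (z' \<oplus> \<omega> v')" "c < \<omega> (z' \<oplus> \<omega> v')" "\<omega> (z' \<oplus> \<omega> v') < x"
        using oexp_approximation[OF \<open>c < x\<close>[unfolded x_def] \<open>m < v\<close>] unfolding x_def by metis
      define x' where "x' = \<omega> (z' \<oplus> \<omega> v')"
      have x': "x' < x" "v' < x'" "c < x'" using v' by (simp_all add: x'_def)
      have below: "f b < x'" "b < x'" if "b \<in> B" "b < x" for b
        using c[OF that] f[of b] that x'(3) by (auto intro: order.strict_trans1 order.strict_trans)
      have lt1_iff_x: "b \<lhd> x \<longleftrightarrow> b \<lhd> x'" if "b \<in> B" "b < x" for b
        using f[OF that(2)] below[OF that] x'(1) lt1_downward[of b x x'] lt1_downward[of b x' "f b"]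
        by (auto simp: less_imp_le)
      define h where "h y = (if y < x then y else x' \<oplus> (THE \<eta>. y = x \<oplus> \<eta>))" for y
      have h_low: "h y = y" if "y < x" for y using that by (simp add: h_def)
      have h_high: "h (x \<oplus> \<eta>) = x' \<oplus> \<eta>" for \<eta>
        using le_oadd_left[of x \<eta>] by (auto simp: h_def not_less[symmetric])
      have cases: "y < x' \<and> h y = y \<or> (\<exists>\<eta>\<in>N. y = x \<oplus> \<eta> \<and> h y = x' \<oplus> \<eta>)" if "y \<in> B" for y
      proof (cases "y < x")
        case True
        then show ?thesis using below(2) h_low that by blast
      next
        case False
        then obtain \<eta> where "y = x \<oplus> \<eta>" using le_iff_oadd not_less by blast
        then show ?thesis using h_high that by (auto simp: N_def)
      qed
      have Nx': "\<eta> < x'" "\<eta> \<le> v'" "\<eta> \<le> v" if "\<eta> \<in> N" for \<eta>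
        using mN[OF that] v'(1) x'(2) \<open>m < v\<close> by (auto intro: order.trans order.strict_trans1 less_imp_le)
      have "iso_plus lt1 B h"
      proof (rule iso_plus_shift[OF x_def x'_def x'(1) Nx'(1) cases])
        fix \<eta> assume \<eta>: "\<eta> \<in> N" "\<eta> \<noteq> \<zero>"
        then show "x \<lhd> x \<oplus> \<eta> \<and> x' \<lhd> x' \<oplus> \<eta>"
          unfolding x_def x'_def using lt1_IH N Nx'(2,3) by blast
      next
        fix y \<eta> assume y: "y \<in> B" "y < x'" "\<eta> \<in> N"
        have yx: "y < x" using y(2) x'(1) by (rule order.strict_trans)
        \<comment> \<open>A connection from a low point to the base extends to the shifted point by
          transitivity, and the converse is downward closure. So only the connection to the base
          matters.\<close>
        have up: "y \<lhd> x \<Longrightarrow> y \<lhd> x \<oplus> \<eta>" 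
          using lt1_IH[of \<eta> v z] N[OF y(3)] Nx'(3)[OF y(3)] lt1_trans by (metis oadd_zero x_def)
        have up': "y \<lhd> x' \<Longrightarrow> y \<lhd> x' \<oplus> \<eta>" 
          using lt1_IH[of \<eta> v' z'] N[OF y(3)] Nx'(2)[OF y(3)] lt1_trans by (metis oadd_zero x'_def)
        show "y \<lhd> x \<oplus> \<eta> \<longleftrightarrow> y \<lhd> x' \<oplus> \<eta>"
          using up up' lt1_iff_x[OF y(1) yx] lt1_downward[OF _ yx le_oadd_left] lt1_downward[OF _ y(2) le_oadd_left]
          by blast
      qed
      moreover have "h ` B \<subseteq> {..<x}"
      proof -
        have "x' \<oplus> \<eta> < x" if "\<eta> \<in> N" for \<eta>
          using x'(1) Nx'(1)[OF that] unfolding x_def by (intro oadd_less_oexp) auto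
        then have "h y < x" if "y \<in> B" for y
          using cases[OF that] x'(1) by (auto intro: order.strict_trans)
        then show ?thesis by auto
      qed
      ultimately show ?thesis using h_low by blast
    qed
    then have "x \<lhd> x \<oplus> \<xi>" using False by (intro lt1I) simp_all
    then show "x \<unlhd> x \<oplus> \<xi>" by (simp add: le1_def)
  qed
qed

text \<open>Reflecting \<open>\<omega> z\<close>, \<open>v\<close>, \<open>x\<close> and
  \<open>x \<oplus> v\<close> fixes the first two. The image \<open>h x\<close> is a power between
  \<open>\<omega> z\<close> and \<open>x\<close>, so its trailing exponent \<open>w\<close> is
  smaller than \<open>v\<close>; yet \<open>h x\<close> is connected to
  \<open>h x \<oplus> v\<close>, which lies beyond \<open>h x \<oplus> w\<close>. The induction
  hypothesis for \<open>w\<close> excludes this.\<close>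

lemma not_lt1_osucc_oadd:
  assumes "v < \<omega> (z \<oplus> \<omega> v)"
  shows "\<not> \<omega> (z \<oplus> \<omega> v) \<lhd> osucc (\<omega> (z \<oplus> \<omega> v) \<oplus> v)"
  using assms
proof (induction v arbitrary: z rule: less_induct)
  case (less v)
  define x where "x = \<omega> (z \<oplus> \<omega> v)"
  have vx: "v < x" using less.prems by (simp add: x_def)
  have zx: "\<omega> z < x" by (simp add: x_def)
  show ?case unfolding x_def[symmetric]
  proof
    assume lt1: "x \<lhd> osucc (x \<oplus> v)"
    have B: "{\<omega> z, v, x, x \<oplus> v} \<subseteq> {..<osucc (x \<oplus> v)}"
      using zx vx le_oadd_left[of x v] by (auto intro: less_imp_le order.trans order.strict_trans2)
    obtain h where h: "iso_plus lt1 {\<omega> z, v, x, x \<oplus> v} h" "h ` {\<omega> z, v, x, x \<oplus> v} \<subseteq> {..<x}"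
      "\<And>y. y \<in> {\<omega> z, v, x, x \<oplus> v} \<Longrightarrow> y < x \<Longrightarrow> h y = y"
      using lt1E[OF lt1 _ B] by blast
    have fixed: "h (\<omega> z) = \<omega> z" "h v = v" using h(3) zx vx by auto
    have hx: "h x < x" using h(2) by simp
    show False
    \<comment> \<open>For \<open>v = \<zero>\<close> the points \<open>x\<close> and
      \<open>x \<oplus> v\<close> coincide, so the sum \<open>\<omega> z \<oplus> x = x\<close> is
      transported instead: absorbing \<open>\<omega> z\<close> forces \<open>h x\<close> up to
      \<open>x\<close>.\<close>
    proof (cases "v = \<zero>")
      case True
      then have "x = \<omega> (osucc z)" by (simp add: x_def oexp_zero)
      moreover have "\<omega> z \<oplus> x = x" using zx oadd_oexp_absorb x_def by blast
      then have "\<omega> z \<oplus> h x = h x" using iso_plusD(3)[OF h(1), of "\<omega> z" x x] fixed by simp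
      ultimately have "x \<le> h x" using oexp_osucc_le_if_absorbed by blast
      then show False using hx by simp
    next
      case False
      have sum: "h (x \<oplus> v) = h x \<oplus> v"
        using iso_plusD(3)[OF h(1), of x v "x \<oplus> v"] fixed by simp
      have "x \<lhd> x \<oplus> v" using lt1 by (rule lt1_downward) (use False in \<open>auto simp: less_imp_le\<close>)
      then have lt1': "h x \<lhd> h x \<oplus> v"
        using iso_plusD(2)[OF h(1), of x "x \<oplus> v"] sum by simp
      obtain q w where q: "h x = \<omega> (q \<oplus> \<omega> w)" using lt1_imp_oexp[OF lt1'] .
      have "\<omega> z < h x" "v < h x"
        using iso_plusD(1)[OF h(1), of "\<omega> z" x] iso_plusD(1)[OF h(1), of v x] fixed zx vx by simp_all
      then have "z < q \<oplus> \<omega> w" using q by simp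
      then have "z \<oplus> \<omega> w \<le> q \<oplus> \<omega> w" by (rule oadd_trailing_le)
      also have "\<dots> < z \<oplus> \<omega> v" using hx q by (simp add: x_def)
      finally have "w < v" by simp
      then have "\<not> h x \<lhd> osucc (h x \<oplus> w)"
        using less.IH[of w q] q \<open>v < h x\<close> by (auto intro: order.strict_trans)
      moreover have "h x \<lhd> osucc (h x \<oplus> w)"
        using lt1' by (rule lt1_downward) (use \<open>w < v\<close> in auto)
      ultimately show False by blast
    qed
  qed
qed

text \<open>If \<open>w < v\<close>, downward closure reaches the first point that
  \<open>not_lt1_osucc_oadd\<close> forbids. The bound on \<open>v\<close> allows equality with the
  power, as needed to recognise epsilon numbers.\<close>

lemma lt1_oadd_bound:
  assumes "\<omega> (q \<oplus> \<omega> w) \<lhd> \<omega> (q \<oplus> \<omega> w) \<oplus> v" "v \<le> \<omega> (q \<oplus> \<omega> w)"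
  shows "v \<le> w"
proof (rule ccontr)
  assume "\<not> v \<le> w"
  then have "w < v" by simp
  then have "\<omega> (q \<oplus> \<omega> w) \<lhd> osucc (\<omega> (q \<oplus> \<omega> w) \<oplus> w)"
    by (intro lt1_downward[OF assms(1)]) auto
  moreover have "w < \<omega> (q \<oplus> \<omega> w)" using \<open>w < v\<close> assms(2) by (rule order.strict_trans2)
  ultimately show False using not_lt1_osucc_oadd by blast
qed

text \<open>This describes \<open>lt1\<close> above a power that is not an epsilon number by order
  and addition alone. Substitution preserves both, and therefore such pairs.\<close>

lemma lt1_oexp_iff:
  assumes "v < \<omega> (z \<oplus> \<omega> v)"
  shows "\<omega> (z \<oplus> \<omega> v) \<lhd> y \<longleftrightarrow> \<omega> (z \<oplus> \<omega> v) < y \<and> y \<le> \<omega> (z \<oplus> \<omega> v) \<oplus> v"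
proof
  assume y: "\<omega> (z \<oplus> \<omega> v) \<lhd> y"
  have "y \<le> \<omega> (z \<oplus> \<omega> v) \<oplus> v"
  proof (rule ccontr)
    assume "\<not> y \<le> \<omega> (z \<oplus> \<omega> v) \<oplus> v"
    then have "\<omega> (z \<oplus> \<omega> v) \<lhd> osucc (\<omega> (z \<oplus> \<omega> v) \<oplus> v)"
      by (intro lt1_downward[OF y]) auto
    then show False using not_lt1_osucc_oadd[OF assms] by blast
  qed
  then show "\<omega> (z \<oplus> \<omega> v) < y \<and> y \<le> \<omega> (z \<oplus> \<omega> v) \<oplus> v" using lt1_less[OF y] by blast
next
  assume y: "\<omega> (z \<oplus> \<omega> v) < y \<and> y \<le> \<omega> (z \<oplus> \<omega> v) \<oplus> v"
  then have "\<omega> (z \<oplus> \<omega> v) \<lhd> \<omega> (z \<oplus> \<omega> v) \<oplus> v"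
    using le1_oexp_oadd[of v v z] by (auto simp: le1_def)
  then show "\<omega> (z \<oplus> \<omega> v) \<lhd> y" using y lt1_downward by blast
qed

text \<open>An epsilon number is its own trailing exponent:
  \<open>e = \<omega> (\<zero> \<oplus> \<omega> e)\<close>.\<close>

lemma eps_lt1_double: "is_eps e \<Longrightarrow> e \<lhd> e \<oplus> e"
  using le1_oexp_oadd[of e e \<zero>] oexp_neq_zero[of e] by (simp add: is_eps_def le1_def)

lemma lt1_double_imp_eps:
  assumes "x \<lhd> x \<oplus> x"
  shows "is_eps x"
proof -
  obtain q w where x: "x = \<omega> (q \<oplus> \<omega> w)" using lt1_imp_oexp[OF assms] .
  have "x \<le> w" using lt1_oadd_bound[of q w x] assms x by simp
  then have "\<omega> x \<le> \<omega> w" by simp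
  also have "\<dots> \<le> q \<oplus> \<omega> w" by simp
  also have "\<dots> \<le> x" using x le_oexp by metis
  finally show ?thesis by (simp add: is_eps_def order.antisym)
qed

section \<open>Cantor normal form\<close>

text \<open>The identity as \<open>f\<close> gives the value of a normal form, and
  \<open>subst a e\<close> gives the sum in the substitution clause. One evaluation serves
  both.\<close>

definition wsum :: "('a \<Rightarrow> 'a) \<Rightarrow> ('a \<times> nat) list \<Rightarrow> 'a" where
  "wsum f xs = foldl oadd \<zero> (map (\<lambda>(L, l). f L \<odot> l) xs)"

definition terms :: "'a \<Rightarrow> 'a set" where
  "terms x = fst ` set (cnf x)"

lemma foldl_oadd: "foldl oadd a ys = a \<oplus> foldl oadd \<zero> ys"
proof (induction ys arbitrary: a)
  case (Cons y ys)
  show ?case using Cons[of "a \<oplus> y"] Cons[of "\<zero> \<oplus> y"] by (simp add: oadd_assoc)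
qed simp

lemma wsum_Nil [simp]: "wsum f [] = \<zero>"
  by (simp add: wsum_def)

lemma wsum_Cons [simp]: "wsum f (p # xs) = f (fst p) \<odot> snd p \<oplus> wsum f xs"
  unfolding wsum_def by (simp add: split_beta) (rule foldl_oadd)

lemma wsum_append [simp]: "wsum f (xs @ ys) = wsum f xs \<oplus> wsum f ys"
  by (induction xs) (simp_all add: oadd_assoc)

lemma cnf_val_eq: "cnf_val xs = wsum (\<lambda>x. x) xs"
  by (simp add: cnf_val_def wsum_def)

lemma principal_oexp [simp]: "principal (\<omega> x)"
  by (auto simp: principal_def)

lemma principal_pos: "principal (L::'a) \<Longrightarrow> L \<noteq> \<zero>"
  by (auto simp: principal_def)

lemma not_principal_zero [simp]: "\<not> principal \<zero>"
  by (auto simp: principal_def)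

lemma is_cnf_Nil [simp]: "is_cnf ([] :: ('a \<times> nat) list)"
  by (simp add: is_cnf_def)

lemma is_cnf_Cons: "is_cnf (p # xs) \<longleftrightarrow>
    principal (fst p :: 'a) \<and> 0 < snd p \<and> (\<forall>q\<in>set xs. fst q < fst p) \<and> is_cnf xs"
  by (auto simp: is_cnf_def)

lemma is_cnf_append: "is_cnf (xs @ ys) \<longleftrightarrow>
    is_cnf xs \<and> is_cnf ys \<and> (\<forall>p\<in>set xs. \<forall>q\<in>set ys. fst q < (fst p :: 'a))"
  by (auto simp: is_cnf_def sorted_wrt_append)

lemma cnf_val_less:
  assumes "\<forall>p\<in>set xs. fst p < M" "principal M"
  shows "wsum (\<lambda>x. x) xs < M"
  using assms(1)
proof (induction xs)
  case Nil
  then show ?case using principal_pos[OF assms(2)] by (simp add: ozero_less_iff)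
next
  case (Cons p xs)
  obtain z where M: "M = \<omega> z" using assms(2) by (auto simp: principal_def)
  have "fst p \<odot> snd p < M" "wsum (\<lambda>x. x) xs < M" using Cons M mult_less_oexp by auto
  then show ?case unfolding M by (simp add: oadd_less_oexp)
qed

lemma fst_le_cnf_val: "p \<in> set xs \<Longrightarrow> 0 < snd p \<Longrightarrow> fst p \<le> wsum (\<lambda>x. x) xs"
proof (induction xs)
  case (Cons q xs)
  show ?case
  proof (cases "p = q")
    case True
    then have "fst p \<odot> Suc 0 \<le> fst q \<odot> snd q" using Cons.prems(2) by (intro mult_mono) auto
    then show ?thesis by (simp add: order.trans[OF _ le_oadd_left])
  next
    case False
    then have "fst p \<le> wsum (\<lambda>x. x) xs" using Cons by simp
    then show ?thesis by (simp add: order.trans[OF _ le_oadd_right])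
  qed
qed simp

text \<open>A normal form whose terms are all below a power \<open>M\<close> has value below
  \<open>M\<close>. Comparing values thus forces equal leading powers, then equal leading
  coefficients, and cancellation leaves the tails.\<close>

lemma is_cnf_unique:
  "is_cnf xs \<Longrightarrow> is_cnf ys \<Longrightarrow> wsum (\<lambda>x. x) xs = wsum (\<lambda>x::'a. x) ys \<Longrightarrow> xs = ys"
proof (induction xs arbitrary: ys)
  case Nil
  have "ys = []"
  proof (cases ys)
    case (Cons q ys')
    then have "fst q \<le> \<zero>" using fst_le_cnf_val[of q ys] Nil by (simp add: is_cnf_Cons)
    then show ?thesis using Nil Cons by (simp add: is_cnf_Cons)
  qed simp
  then show ?case by simp
next
  case (Cons p xs)
  obtain q zs where ys: "ys = q # zs"
  proof (cases ys)
    case Nil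
    then have "fst p \<le> \<zero>" using fst_le_cnf_val[of p "p # xs"] Cons.prems by (simp add: is_cnf_Cons)
    then show ?thesis using Cons.prems by (simp add: is_cnf_Cons)
  qed blast
  have cnfs: "is_cnf xs" "is_cnf zs" "principal (fst p)" "principal (fst q)" "0 < snd p" "0 < snd q"
    and rest: "\<forall>r\<in>set xs. fst r < fst p" "\<forall>r\<in>set zs. fst r < fst q"
    using Cons.prems ys by (auto simp: is_cnf_Cons)
  have eq: "fst p \<odot> snd p \<oplus> wsum (\<lambda>x. x) xs = fst q \<odot> snd q \<oplus> wsum (\<lambda>x. x) zs"
    using Cons.prems(3) ys by simp
  have less: "\<not> fst r < fst s"
    if "\<forall>t\<in>set us. fst t < fst r" "principal (fst s)" "0 < snd s"
      "fst r \<odot> snd r \<oplus> wsum (\<lambda>x. x) us = fst s \<odot> snd s \<oplus> wsum (\<lambda>x. x) vs" for r s :: "'a \<times> nat" and us vs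
  proof
    assume rs: "fst r < fst s"
    then have "wsum (\<lambda>x. x) (r # us) < fst s" using that by (intro cnf_val_less) auto
    moreover have "fst s \<le> wsum (\<lambda>x. x) (s # vs)" using that by (intro fst_le_cnf_val) auto
    ultimately show False using that(4) by simp
  qed
  have L: "fst p = fst q"
    using less[OF rest(1) cnfs(4,6) eq] less[OF rest(2) cnfs(3,5) eq[symmetric]] by simp
  have coeff: "\<not> m < n" if "\<forall>t\<in>set us. fst t < M" "principal M"
      "M \<odot> m \<oplus> wsum (\<lambda>x. x) us = M \<odot> n \<oplus> wsum (\<lambda>x. x) vs" for m n M us vs
  proof
    assume "m < n"
    have "M \<odot> m \<oplus> wsum (\<lambda>x. x) us < M \<odot> m \<oplus> M" using cnf_val_less[OF that(1,2)] by simp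
    also have "\<dots> = M \<odot> Suc m" by simp
    also have "\<dots> \<le> M \<odot> n" using \<open>m < n\<close> by (intro mult_mono) auto
    also have "\<dots> \<le> M \<odot> n \<oplus> wsum (\<lambda>x. x) vs" by simp
    finally show False using that(3) by simp
  qed
  have l: "snd p = snd q"
    using coeff[OF rest(1) cnfs(3) eq[folded L]] coeff[OF rest(2)[folded L] cnfs(3) eq[symmetric, folded L]]
    by simp
  have "wsum (\<lambda>x. x) xs = wsum (\<lambda>x. x) zs" using eq L l by simp
  then have "xs = zs" using Cons.IH[OF cnfs(1,2)] by simp
  then show ?case using ys L l by (simp add: prod_eq_iff)
qed

text \<open>Split off the leading power and take a normal form of the remainder. If that starts with
  the same power, its coefficient is increased; otherwise a new entry is prepended.\<close>

lemma is_cnf_exists: "\<exists>xs. is_cnf xs \<and> wsum (\<lambda>x. x) xs = (x::'a)"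
proof (induction x rule: less_induct)
  case (less x)
  show ?case
  proof (cases "x = \<zero>")
    case True
    then show ?thesis by (intro exI[of _ "[]"]) simp
  next
    case False
    then obtain a r where r: "x = \<omega> a \<oplus> r" "r < x" "x < \<omega> (osucc a)" using leading_term by blast
    obtain ys where ys: "is_cnf ys" "wsum (\<lambda>x. x) ys = r" using less[OF r(2)] by blast
    have le: "fst p \<le> \<omega> a" if "p \<in> set ys" for p
    proof -
      have "fst p \<le> r" using fst_le_cnf_val[OF that] ys that by (auto simp: is_cnf_def)
      then have "fst p < \<omega> (osucc a)" using r(2,3) by (auto elim: order.strict_trans order.strict_trans1)
      moreover have "principal (fst p)" using ys(1) that by (simp add: is_cnf_def)
      then obtain c where "fst p = \<omega> c" by (metis principal_def)
      ultimately show ?thesis by simp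
    qed
    show ?thesis
    proof (cases "\<exists>l zs. ys = (\<omega> a, l) # zs")
      case True
      then obtain l zs where "ys = (\<omega> a, l) # zs" by blast
      then have "is_cnf ((\<omega> a, Suc l) # zs) \<and> wsum (\<lambda>x. x) ((\<omega> a, Suc l) # zs) = x"
        using ys r(1) by (auto simp: is_cnf_Cons mult_Suc_left oadd_assoc simp del: ntimes.simps)
      then show ?thesis by blast
    next
      case False
      have "fst q < \<omega> a" if "q \<in> set ys" for q
      proof (cases ys)
        case Nil
        then show ?thesis using that by simp
      next
        case (Cons p zs)
        then have "fst p \<noteq> \<omega> a" using False by (metis prod.collapse)
        then have "fst p < \<omega> a" using le[of p] Cons by simp
        then show ?thesis using that Cons ys(1) by (auto simp: is_cnf_Cons elim: order.strict_trans)
      qed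
      then have "is_cnf ((\<omega> a, 1) # ys) \<and> wsum (\<lambda>x. x) ((\<omega> a, 1) # ys) = x"
        using ys r(1) by (simp add: is_cnf_Cons)
      then show ?thesis by blast
    qed
  qed
qed

lemma cnf_unique: "is_cnf xs \<Longrightarrow> cnf (wsum (\<lambda>x::'a. x) xs) = xs"
  unfolding cnf_def cnf_val_eq using is_cnf_unique by (intro the_equality) auto

lemma is_cnf_cnf [simp]: "is_cnf (cnf (x::'a))"
  and wsum_cnf [simp]: "wsum (\<lambda>x. x) (cnf x) = x"
  using is_cnf_exists[of x] cnf_unique by auto

lemma cnf_zero [simp]: "cnf \<zero> = []"
  using cnf_unique[of "[]"] by simp

lemma cnf_oexp [simp]: "cnf (\<omega> x) = [(\<omega> x, Suc 0)]"
  using cnf_unique[of "[(\<omega> x, Suc 0)]"] by (simp add: is_cnf_Cons)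

lemma terms_zero [simp]: "terms \<zero> = {}"
  by (simp add: terms_def)

lemma terms_oexp [simp]: "terms (\<omega> x) = {\<omega> x}"
  by (simp add: terms_def)

lemma finite_terms [simp]: "finite (terms x)"
  by (simp add: terms_def)

lemma terms_le: "L \<in> terms x \<Longrightarrow> L \<le> x"
  using fst_le_cnf_val[of _ "cnf x"] is_cnf_cnf[of x] by (auto simp: terms_def is_cnf_def)

lemma terms_principal: "L \<in> terms x \<Longrightarrow> \<exists>c. L = \<omega> c"
  using is_cnf_cnf[of x] by (force simp: terms_def is_cnf_def principal_def)

lemma olog_oexp [simp]: "olog (\<omega> x) = x"
  by (simp add: olog_def)

text \<open>A power not exceeding any present term either increases the last coefficient or becomes
  a new last entry. Both conclusions are insensitive to which of the two happens.\<close>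

lemma
  assumes "\<And>L. L \<in> terms x \<Longrightarrow> \<omega> b \<le> L"
  shows terms_snoc: "terms (x \<oplus> \<omega> b) = insert (\<omega> b) (terms x)"
    and wsum_snoc: "wsum f (cnf (x \<oplus> \<omega> b)) = wsum f (cnf x) \<oplus> f (\<omega> b)"
proof -
  have "terms (x \<oplus> \<omega> b) = insert (\<omega> b) (terms x) \<and> wsum f (cnf (x \<oplus> \<omega> b)) = wsum f (cnf x) \<oplus> f (\<omega> b)"
  proof (cases "\<exists>zs l. cnf x = zs @ [(\<omega> b, l)]")
    case True
    then obtain zs l where zs: "cnf x = zs @ [(\<omega> b, l)]" by blast
    have "is_cnf (zs @ [(\<omega> b, Suc l)])"
      using is_cnf_cnf[of x] zs by (auto simp: is_cnf_append is_cnf_Cons)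
    then have "cnf (wsum (\<lambda>x. x) (zs @ [(\<omega> b, Suc l)])) = zs @ [(\<omega> b, Suc l)]"
      by (rule cnf_unique)
    moreover have "wsum (\<lambda>x. x) (zs @ [(\<omega> b, Suc l)]) = x \<oplus> \<omega> b"
      using wsum_cnf[of x] zs by (simp add: oadd_assoc[symmetric])
    ultimately have "cnf (x \<oplus> \<omega> b) = zs @ [(\<omega> b, Suc l)]" by simp
    then show ?thesis using zs by (auto simp: terms_def oadd_assoc)
  next
    case False
    have "\<omega> b < fst p" if "p \<in> set (cnf x)" for p
    proof -
      have "cnf x \<noteq> []" using that by auto
      then obtain zs q where zs: "cnf x = zs @ [q]" by (metis rev_exhaust)
      then have "fst q \<noteq> \<omega> b" using False by (metis prod.collapse)
      moreover have "\<omega> b \<le> fst q" using assms zs by (simp add: terms_def)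
      ultimately have "\<omega> b < fst q" by simp
      moreover have "fst q \<le> fst p"
        using that zs is_cnf_cnf[of x] by (auto simp: is_cnf_append intro: less_imp_le)
      ultimately show ?thesis by (rule order.strict_trans2)
    qed
    then have "is_cnf (cnf x @ [(\<omega> b, Suc 0)])"
      by (simp add: is_cnf_append is_cnf_Cons)
    then have "cnf (wsum (\<lambda>x. x) (cnf x @ [(\<omega> b, Suc 0)])) = cnf x @ [(\<omega> b, Suc 0)]"
      by (rule cnf_unique)
    then have "cnf (x \<oplus> \<omega> b) = cnf x @ [(\<omega> b, Suc 0)]" by simp
    then show ?thesis by (simp add: terms_def)
  qed
  then show "terms (x \<oplus> \<omega> b) = insert (\<omega> b) (terms x)"
    "wsum f (cnf (x \<oplus> \<omega> b)) = wsum f (cnf x) \<oplus> f (\<omega> b)" by blast+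
qed

text \<open>Normal forms are built one trailing power at a time, so that coefficients disappear from
  inductive proofs.\<close>

lemma cnf_induct [case_names zero snoc]:
  assumes zero: "P \<zero>"
    and snoc: "\<And>x b. P x \<Longrightarrow> (\<And>L. L \<in> terms x \<Longrightarrow> \<omega> b \<le> L) \<Longrightarrow> P (x \<oplus> \<omega> b)"
  shows "P x"
proof -
  have "P (wsum (\<lambda>x. x) xs)" if "is_cnf xs" for xs
    using that
  proof (induction xs rule: rev_induct)
    case Nil
    then show ?case using zero by simp
  next
    case (snoc p xs)
    have "principal (fst p)" using snoc.prems by (simp add: is_cnf_append is_cnf_Cons)
    then obtain b where b: "fst p = \<omega> b" by (metis principal_def)
    have "P (wsum (\<lambda>x. x) xs \<oplus> \<omega> b \<odot> n)" for n
    proof (induction n)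
      case 0
      then show ?case using snoc by (simp add: is_cnf_append)
    next
      case (Suc n)
      \<comment> \<open>An entry with coefficient zero is not allowed in a normal form, so
        \<open>n = 0\<close> is treated separately.\<close>
      define ys where "ys = (if n = 0 then xs else xs @ [(\<omega> b, n)])"
      have "is_cnf ys" using snoc.prems b by (auto simp: ys_def is_cnf_append is_cnf_Cons)
      then have "cnf (wsum (\<lambda>x. x) ys) = ys" by (rule cnf_unique)
      moreover have "wsum (\<lambda>x. x) ys = wsum (\<lambda>x. x) xs \<oplus> \<omega> b \<odot> n" by (simp add: ys_def)
      ultimately have "terms (wsum (\<lambda>x. x) xs \<oplus> \<omega> b \<odot> n) = fst ` set ys" by (simp add: terms_def)
      moreover have "\<forall>q\<in>set ys. \<omega> b \<le> fst q"
        using snoc.prems b by (auto simp: ys_def is_cnf_append is_cnf_Cons intro: less_imp_le)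
      ultimately show ?case using assms(2)[OF Suc, of b] by (auto simp: oadd_assoc)
    qed
    then show ?case using b by simp
  qed
  then show ?thesis using is_cnf_cnf wsum_cnf by metis
qed

text \<open>Adding \<open>\<omega> b\<close> absorbs the terms below it and keeps the
  others.\<close>

lemma terms_oadd_oexp:
  shows "terms (x \<oplus> \<omega> b) \<subseteq> insert (\<omega> b) (terms x)"
    and "\<omega> b \<in> terms (x \<oplus> \<omega> b)"
    and "L \<in> terms x \<Longrightarrow> \<omega> b \<le> L \<Longrightarrow> L \<in> terms (x \<oplus> \<omega> b)"
proof -
  have "terms (x \<oplus> \<omega> b) \<subseteq> insert (\<omega> b) (terms x) \<and> \<omega> b \<in> terms (x \<oplus> \<omega> b)
    \<and> (\<forall>L\<in>terms x. \<omega> b \<le> L \<longrightarrow> L \<in> terms (x \<oplus> \<omega> b))"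
  proof (induction x rule: cnf_induct)
    case zero
    then show ?case by simp
  next
    case (snoc x c)
    show ?case
    proof (cases "b \<le> c")
      case True
      have x: "terms (x \<oplus> \<omega> c) = insert (\<omega> c) (terms x)" using snoc.hyps by (rule terms_snoc)
      have "\<omega> b \<le> L" if "L \<in> terms (x \<oplus> \<omega> c)" for L
        using that snoc.hyps True unfolding x by (auto intro: order.trans[of "\<omega> b" "\<omega> c"])
      then show ?thesis using terms_snoc by auto
    next
      case False
      then have "x \<oplus> \<omega> c \<oplus> \<omega> b = x \<oplus> \<omega> b" by (simp add: oadd_assoc oadd_oexp_absorb)
      moreover have "terms (x \<oplus> \<omega> c) = insert (\<omega> c) (terms x)" using snoc.hyps by (rule terms_snoc)
      ultimately show ?thesis using snoc.IH False by auto
    qed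
  qed
  then show "terms (x \<oplus> \<omega> b) \<subseteq> insert (\<omega> b) (terms x)" "\<omega> b \<in> terms (x \<oplus> \<omega> b)"
    "L \<in> terms x \<Longrightarrow> \<omega> b \<le> L \<Longrightarrow> L \<in> terms (x \<oplus> \<omega> b)" by blast+
qed

lemma terms_oadd_subset: "terms (x \<oplus> y) \<subseteq> terms x \<union> terms y"
proof (induction y rule: cnf_induct)
  case (snoc y b)
  then show ?case using terms_oadd_oexp(1)[where x = "x \<oplus> y" and b = b] terms_snoc[OF snoc.hyps]
    by (auto simp: oadd_assoc)
qed simp

lemma terms_subset_oadd: "terms y \<subseteq> terms (x \<oplus> y)"
proof (induction y rule: cnf_induct)
  case (snoc y b)
  have "terms (y \<oplus> \<omega> b) = insert (\<omega> b) (terms y)" using snoc.hyps by (rule terms_snoc)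
  then show ?case using terms_oadd_oexp(2,3)[where x = "x \<oplus> y" and b = b] snoc
    by (auto simp: oadd_assoc)
qed simp

section \<open>Epsilon numbers and substitution\<close>

lemma is_eps_oexp [simp]: "is_eps (\<omega> x) \<longleftrightarrow> is_eps x"
  by (simp add: is_eps_def)

lemma not_is_eps_zero [simp]: "\<not> is_eps \<zero>"
  by (simp add: is_eps_def)

lemma less_oexp_if_not_eps: "\<not> is_eps x \<Longrightarrow> x < \<omega> x"
  by (metis is_eps_def le_less le_oexp)

lemma not_cnf_multi_oexp [simp]: "\<not> cnf_multi (\<omega> x)"
  by (simp add: cnf_multi_def)

text \<open>These are the clauses of \<open>Ep\<close> and \<open>subst\<close>, together with the
  strict descent of the recursive arguments that removes the cuts.\<close>

lemma eps_cases [case_names zero eps oexp multi]: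
  obtains "x = \<zero>" | "is_eps x" | c where "x = \<omega> c" "c < x" "\<not> is_eps c"
  | "x \<noteq> \<zero>" "\<not> is_eps x" "cnf_multi x" "\<And>L. L \<in> terms x \<Longrightarrow> L < x"
proof -
  have "\<exists>c. x = \<omega> c \<and> c < x \<and> \<not> is_eps c" if x: "x \<noteq> \<zero>" "\<not> is_eps x" "\<not> cnf_multi x"
  proof -
    obtain p ps where p: "cnf x = p # ps" using x(1) wsum_cnf[of x] by (cases "cnf x") auto
    then have ps: "ps = []" using x(3) by (cases ps) (auto simp: cnf_multi_def)
    have "principal (fst p)" "0 < snd p" using is_cnf_cnf[of x] p by (simp_all add: is_cnf_Cons)
    moreover have "snd p < 2" using x(3) p ps by (simp add: cnf_multi_def)
    ultimately have "snd p = Suc 0" by simp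
    then have "fst p = x" using wsum_cnf[of x] p ps by simp
    then obtain c where c: "x = \<omega> c" using \<open>principal (fst p)\<close> by (metis principal_def)
    have "c < x" using c x(2) less_oexp_if_not_eps by simp
    then show ?thesis using c x(2) by auto
  qed
  moreover have "L < x" if "cnf_multi x" "L \<in> terms x" for L
  proof -
    have "L \<noteq> x" using terms_principal[OF that(2)] that(1) by auto
    then show ?thesis using terms_le[OF that(2)] by simp
  qed
  ultimately show ?thesis using that by blast
qed

section \<open>Epsilon numbers occurring in an ordinal\<close>

lemma Ep_rec: "Ep (x::'a) = (if is_eps x then {x} else if x = \<zero> then {}
    else if cnf_multi x then (\<Union>L\<in>terms x. cut Ep ord_rel x L) else cut Ep ord_rel x (olog x))"
  unfolding terms_def by (rule def_wfrec[OF eq_reflection[OF Ep_def] wf_ord_rel])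

lemma Ep_zero [simp]: "Ep \<zero> = {}"
  by (simp add: Ep_rec)

lemma Ep_eps: "is_eps x \<Longrightarrow> Ep (x::'a) = {x}"
  by (simp add: Ep_rec)

lemma Ep_oexp [simp]: "Ep (\<omega> x) = Ep x"
proof (cases "is_eps x")
  case True
  then show ?thesis by (simp add: is_eps_def)
next
  case False
  then have "x < \<omega> x" by (rule less_oexp_if_not_eps)
  then show ?thesis using False by (subst Ep_rec) simp
qed

lemma Ep_terms: "Ep x = (\<Union>L\<in>terms x. Ep L)"
proof (cases x rule: eps_cases)
  case eps
  then have "terms x = {x}" using terms_oexp[of x] by (simp add: is_eps_def)
  then show ?thesis by simp
next
  case multi
  then have "Ep x = (\<Union>L\<in>terms x. cut Ep ord_rel x L)" by (subst Ep_rec) simp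
  then show ?thesis using multi(4) by simp
qed simp_all

lemma Ep_oadd_subset: "Ep (x \<oplus> y) \<subseteq> Ep x \<union> Ep y"
  using terms_oadd_subset[of x y] unfolding Ep_terms[of "x \<oplus> y"] Ep_terms[of x] Ep_terms[of y] by blast

lemma Ep_subset_oadd: "Ep y \<subseteq> Ep (x \<oplus> y)"
  using terms_subset_oadd[of y x] unfolding Ep_terms[of "x \<oplus> y"] Ep_terms[of y] by blast

lemma Ep_le: "a \<in> Ep x \<Longrightarrow> a \<le> (x::'a)"
proof (induction x rule: less_induct)
  case (less x)
  show ?case
  proof (cases x rule: eps_cases)
    case zero
    then show ?thesis using less by simp
  next
    case eps
    then show ?thesis using less Ep_eps by simp
  next
    case (oexp c)
    then show ?thesis using less by (metis Ep_oexp less_imp_le order.trans)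
  next
    case multi
    then show ?thesis using less by (subst (asm) (2) Ep_terms) (meson UN_E less_imp_le order.trans)
  qed
qed

text \<open>An ordinal is generated from the epsilon numbers in it by sums and powers, and
  \<open>e\<close> is closed under both.\<close>

lemma Ep_less_imp_less: "is_eps e \<Longrightarrow> Ep x \<subseteq> {..<e} \<Longrightarrow> x < (e::'a)"
proof (induction x rule: less_induct)
  case (less x)
  have e: "\<omega> e = e" using less.prems by (simp add: is_eps_def)
  show ?case
  proof (cases x rule: eps_cases)
    case zero
    then show ?thesis using e by (metis oexp_neq_zero ozero_less_iff)
  next
    case eps
    then show ?thesis using less Ep_eps by simp
  next
    case (oexp c)
    then have "c < e" using less by simp
    then show ?thesis using oexp e oexp_less_iff by metis
  next
    case multi
    have "L < e" if "L \<in> terms x" for L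
      using less multi(4)[OF that] that Ep_terms[of x] by blast
    then have "wsum (\<lambda>x. x) (cnf x) < e"
      using e principal_oexp[of e] by (intro cnf_val_less) (auto simp: terms_def)
    then show ?thesis by simp
  qed
qed

section \<open>Substitution of one epsilon number for another\<close>

lemma wsum_cong: "(\<And>p. p \<in> set xs \<Longrightarrow> f (fst p) = g (fst p)) \<Longrightarrow> wsum f xs = wsum g xs"
  by (induction xs) auto

lemma subst_rec: "subst a e (x::'a) = (if is_eps x then (if x = a then e else x) else if x = \<zero> then \<zero>
    else if cnf_multi x then wsum (cut (subst a e) ord_rel x) (cnf x)
    else \<omega> (cut (subst a e) ord_rel x (olog x)))"
  unfolding wsum_def by (rule def_wfrec[OF eq_reflection[OF subst_def] wf_ord_rel])

lemma subst_zero [simp]: "subst a e \<zero> = \<zero>"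
  by (simp add: subst_rec)

lemma subst_eps: "is_eps x \<Longrightarrow> subst a e (x::'a) = (if x = a then e else x)"
  by (simp add: subst_rec)

lemma subst_oexp:
  assumes "is_eps e"
  shows "subst a e (\<omega> x) = \<omega> (subst a e x)"
proof (cases "is_eps x")
  case True
  then show ?thesis using assms subst_eps[OF True, of a e] by (auto simp: is_eps_def)
next
  case False
  then have "x < \<omega> x" by (rule less_oexp_if_not_eps)
  then show ?thesis using False by (subst subst_rec) simp
qed

text \<open>The sum clause also holds for powers and epsilon numbers, whose normal form is the
  single term itself. This removes the distinction made by \<open>cnf_multi\<close>.\<close>

lemma subst_cnf: "subst a e x = wsum (subst a e) (cnf x)"
proof (cases x rule: eps_cases)
  case eps
  then have "cnf x = [(x, Suc 0)]" using cnf_oexp[of x] by (simp add: is_eps_def)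
  then show ?thesis by simp
next
  case multi
  then have "subst a e x = wsum (cut (subst a e) ord_rel x) (cnf x)" by (subst subst_rec) simp
  also have "\<dots> = wsum (subst a e) (cnf x)"
    using multi(4) by (intro wsum_cong) (simp add: terms_def)
  finally show ?thesis .
qed simp_all

lemma subst_less:
  assumes "is_eps e"
  shows "x < a \<Longrightarrow> subst a e (x::'a) = x"
proof (induction x rule: less_induct)
  case (less x)
  show ?case
  proof (cases x rule: eps_cases)
    case zero
    then show ?thesis by simp
  next
    case eps
    then show ?thesis using less.prems subst_eps[OF eps, of a e] by auto
  next
    case (oexp c)
    then have "subst a e c = c" using less by (auto intro: order.strict_trans)
    then show ?thesis using oexp subst_oexp[OF assms] by metis
  next
    case multi
    have "subst a e L = L" if "L \<in> terms x" for L
      using less multi(4)[OF that] by (auto intro: order.strict_trans)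
    then have "wsum (subst a e) (cnf x) = wsum (\<lambda>x. x) (cnf x)"
      by (intro wsum_cong) (auto simp: terms_def)
    then show ?thesis using subst_cnf by simp
  qed
qed

lemma subst_snoc:
  assumes "is_eps e" "\<And>L. L \<in> terms x \<Longrightarrow> \<omega> b \<le> L"
  shows "subst a e (x \<oplus> \<omega> b) = subst a e x \<oplus> \<omega> (subst a e b)"
  using wsum_snoc[OF assms(2), where f = "subst a e"] subst_cnf subst_oexp[OF assms(1)] by metis

section \<open>Cover sets\<close>

lemma Ep_wsum: "Ep (wsum (\<lambda>x. x) xs) \<subseteq> (\<Union>p\<in>set xs. Ep (fst p))"
proof (induction xs)
  case (Cons p xs)
  have "Ep (fst p \<odot> n) \<subseteq> Ep (fst p)" for n
  proof (induction n)
    case (Suc n)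
    then show ?case using Ep_oadd_subset[of "fst p \<odot> n" "fst p"] by auto
  qed simp
  then show ?case using Cons Ep_oadd_subset[of "fst p \<odot> snd p" "wsum (\<lambda>x. x) xs"] by fastforce
qed simp

lemma Ep_is_eps: "a \<in> Ep (x::'a) \<Longrightarrow> is_eps a"
proof (induction x rule: less_induct)
  case (less x)
  show ?case
  proof (cases x rule: eps_cases)
    case zero
    then show ?thesis using less by simp
  next
    case eps
    then show ?thesis using less Ep_eps by auto
  next
    case (oexp c)
    then show ?thesis using less Ep_oexp by metis
  next
    case multi
    obtain L where "L \<in> terms x" "a \<in> Ep L" using less.prems Ep_terms by blast
    then show ?thesis using less.IH multi(4) by blast
  qed
qed

lemma Ycov_iff: "v \<in> Ycov \<delta> \<longleftrightarrow> (\<exists>z. \<omega> z \<in> terms \<delta> \<and> \<not> is_eps z \<and> \<omega> v \<in> terms z)"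
proof
  assume "v \<in> Ycov \<delta>"
  then obtain L M where L: "v = olog M" "L \<in> terms \<delta>" "\<not> is_eps L" "M \<in> terms (olog L)"
    by (auto simp: Ycov_def terms_def)
  obtain z c where "L = \<omega> z" "M = \<omega> c" using terms_principal L(2,4) by metis
  then show "\<exists>z. \<omega> z \<in> terms \<delta> \<and> \<not> is_eps z \<and> \<omega> v \<in> terms z" using L by auto
next
  assume "\<exists>z. \<omega> z \<in> terms \<delta> \<and> \<not> is_eps z \<and> \<omega> v \<in> terms z"
  then obtain z where "\<omega> z \<in> terms \<delta>" "\<not> is_eps (\<omega> z)" "\<omega> v \<in> terms (olog (\<omega> z))" by auto
  then show "v \<in> Ycov \<delta>" unfolding Ycov_def terms_def
    by (metis (mono_tags, lifting) mem_Collect_eq olog_oexp)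
qed

text \<open>This makes the recursion of \<open>Ccov\<close> well-founded: an exponent of the
  exponent of a non-epsilon term is strictly smaller.\<close>

lemma Ycov_less: "v \<in> Ycov \<delta> \<Longrightarrow> v < (\<delta>::'a)"
proof -
  assume "v \<in> Ycov \<delta>"
  then obtain z where z: "\<omega> z \<in> terms \<delta>" "\<not> is_eps z" "\<omega> v \<in> terms z" using Ycov_iff by blast
  have "v \<le> \<omega> v" by simp
  also have "\<dots> \<le> z" using terms_le[OF z(3)] .
  also have "\<dots> < \<omega> z" using z(2) by (rule less_oexp_if_not_eps)
  also have "\<dots> \<le> \<delta>" using terms_le[OF z(1)] .
  finally show ?thesis .
qed

lemma Ep_Ycov: "v \<in> Ycov \<delta> \<Longrightarrow> Ep v \<subseteq> Ep (\<delta>::'a)"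
proof -
  assume "v \<in> Ycov \<delta>"
  then obtain z where z: "\<omega> z \<in> terms \<delta>" "\<omega> v \<in> terms z" using Ycov_iff by blast
  have "Ep v \<subseteq> Ep z" using z(2) Ep_oexp[of v] Ep_terms[of z] by blast
  moreover have "Ep z \<subseteq> Ep \<delta>" using z(1) Ep_oexp[of z] Ep_terms[of \<delta>] by blast
  ultimately show ?thesis by blast
qed

lemma Ccov_rec: "Ccov (\<delta>::'a) = C1 \<delta> \<union> (\<Union>\<sigma>\<in>C1 \<delta>. C2 \<sigma>) \<union> C2 \<delta> \<union> (\<Union>V\<in>Ycov \<delta>. Ccov V)"
proof -
  have "Ccov \<delta> = C1 \<delta> \<union> (\<Union>\<sigma>\<in>C1 \<delta>. C2 \<sigma>) \<union> C2 \<delta> \<union> (\<Union>V\<in>Ycov \<delta>. cut Ccov ord_rel \<delta> V)"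
    by (rule def_wfrec[OF eq_reflection[OF Ccov_def] wf_ord_rel])
  also have "(\<Union>V\<in>Ycov \<delta>. cut Ccov ord_rel \<delta> V) = (\<Union>V\<in>Ycov \<delta>. Ccov V)"
    by (rule SUP_cong[OF refl]) (simp add: Ycov_less)
  finally show ?thesis .
qed

lemma C1_iff: "y \<in> C1 \<delta> \<longleftrightarrow> (\<exists>z. \<omega> z \<in> terms \<delta> \<and> \<not> is_eps z \<and> y \<in> Fcov (\<omega> z))"
proof
  assume "y \<in> C1 \<delta>"
  then obtain L where L: "L \<in> terms \<delta>" "\<not> is_eps L" "y \<in> Fcov L" by (auto simp: C1_def terms_def)
  then obtain z where "L = \<omega> z" using terms_principal by blast
  then show "\<exists>z. \<omega> z \<in> terms \<delta> \<and> \<not> is_eps z \<and> y \<in> Fcov (\<omega> z)" using L by auto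
next
  assume "\<exists>z. \<omega> z \<in> terms \<delta> \<and> \<not> is_eps z \<and> y \<in> Fcov (\<omega> z)"
  then obtain z where "\<omega> z \<in> terms \<delta>" "\<not> is_eps (\<omega> z)" "y \<in> Fcov (\<omega> z)" by auto
  then show "y \<in> C1 \<delta>" unfolding C1_def terms_def by blast
qed

lemma Fcov_one: "Fcov (\<omega> \<zero>) = {\<omega> \<zero>}"
  by (simp add: Fcov_def oexp_zero)

text \<open>Indexing from zero, in place of the one-based index of \<open>Fcov\<close>, prepares the
  induction along the prefixes.\<close>

lemma Fcov_oexp:
  assumes "\<not> is_eps z" "z \<noteq> \<zero>"
  shows "Fcov (\<omega> z) = (\<Union>g<length (cnf z). \<Union>j\<in>{1..snd (cnf z ! g)}.
    {\<omega> (cnf_prefix (cnf z) (Suc g) j),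
     \<omega> (cnf_prefix (cnf z) (Suc g) j) \<oplus> olog (fst (cnf z ! g))})" (is "_ = ?R")
proof -
  have "\<omega> z \<noteq> osucc \<zero>" using assms(2) oexp_eq_iff[of z \<zero>] by (simp add: oexp_zero)
  then have F: "Fcov (\<omega> z) = {\<omega> (cnf_prefix (cnf z) g j) | g j. 1 \<le> g \<and> g \<le> length (cnf z) \<and> 1 \<le> j \<and> j \<le> snd (cnf z ! (g - 1))}
     \<union> {oadd (\<omega> (cnf_prefix (cnf z) g j)) (olog (fst (cnf z ! (g - 1)))) | g j.
            1 \<le> g \<and> g \<le> length (cnf z) \<and> 1 \<le> j \<and> j \<le> snd (cnf z ! (g - 1))}"
    using assms(1) by (simp add: Fcov_def Let_def)
  show ?thesis
  proof
    show "Fcov (\<omega> z) \<subseteq> ?R"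
    proof
      fix y assume "y \<in> Fcov (\<omega> z)"
      then obtain g j where gj: "1 \<le> g" "g \<le> length (cnf z)" "1 \<le> j" "j \<le> snd (cnf z ! (g - 1))"
        "y = \<omega> (cnf_prefix (cnf z) g j) \<or> y = oadd (\<omega> (cnf_prefix (cnf z) g j)) (olog (fst (cnf z ! (g - 1))))"
        unfolding F by blast
      then obtain g' where "g = Suc g'" by (cases g) auto
      then have "g' \<in> {..<length (cnf z)}" "j \<in> {1..snd (cnf z ! g')}"
        "y \<in> {\<omega> (cnf_prefix (cnf z) (Suc g') j), \<omega> (cnf_prefix (cnf z) (Suc g') j) \<oplus> olog (fst (cnf z ! g'))}"
        using gj by auto
      then show "y \<in> ?R" by blast
    qed
    show "?R \<subseteq> Fcov (\<omega> z)"
    proof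
      fix y assume "y \<in> ?R"
      then obtain g j where gj: "g < length (cnf z)" "1 \<le> j" "j \<le> snd (cnf z ! g)"
        "y = \<omega> (cnf_prefix (cnf z) (Suc g) j) \<or> y = oadd (\<omega> (cnf_prefix (cnf z) (Suc g) j)) (olog (fst (cnf z ! g)))"
        by auto
      have "1 \<le> Suc g \<and> Suc g \<le> length (cnf z) \<and> 1 \<le> j \<and> j \<le> snd (cnf z ! (Suc g - 1))"
        using gj by simp
      note range = this
      from gj(4) show "y \<in> Fcov (\<omega> z)"
      proof
        assume "y = \<omega> (cnf_prefix (cnf z) (Suc g) j)"
        then show ?thesis unfolding F using range by blast
      next
        assume "y = oadd (\<omega> (cnf_prefix (cnf z) (Suc g) j)) (olog (fst (cnf z ! g)))"
        then have "y = oadd (\<omega> (cnf_prefix (cnf z) (Suc g) j)) (olog (fst (cnf z ! (Suc g - 1))))" by simp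
        then show ?thesis unfolding F using range by blast
      qed
    qed
  qed
qed

text \<open>This and the next lemmas walk through an exponent one power at a time: a step adds one
  power, and an exhausted coefficient passes to the next entry with count zero.\<close>

lemma cnf_prefix_Suc: "cnf_prefix zs (Suc g) (Suc j) = cnf_prefix zs (Suc g) j \<oplus> fst (zs ! g)"
  by (simp add: cnf_prefix_def oadd_assoc)

lemma cnf_prefix_zero: "cnf_prefix zs (Suc 0) 0 = \<zero>"
  by (simp add: cnf_prefix_def cnf_val_eq)

lemma cnf_prefix_eq: "cnf_prefix zs (Suc g) j = wsum (\<lambda>x. x) (take g zs @ [(fst (zs ! g), j)])"
  by (simp add: cnf_prefix_def cnf_val_eq)

lemma cnf_prefix_full:
  "g < length zs \<Longrightarrow> cnf_prefix zs (Suc g) (snd (zs ! g)) = wsum (\<lambda>x. x) (take (Suc g) zs)"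
  by (simp add: cnf_prefix_eq take_Suc_conv_app_nth)

lemma cnf_prefix_next:
  "g < length (zs :: ('a \<times> nat) list) \<Longrightarrow> cnf_prefix zs (Suc (Suc g)) 0 = cnf_prefix zs (Suc g) (snd (zs ! g))"
  by (simp add: cnf_prefix_eq take_Suc_conv_app_nth)

lemma Ep_Fcov:
  assumes "y \<in> Fcov (\<omega> z)" "\<not> is_eps z"
  shows "Ep y \<subseteq> Ep z"
proof (cases "z = \<zero>")
  case True
  then show ?thesis using assms(1) by (simp add: Fcov_one)
next
  case False
  have terms: "Ep (fst p) \<subseteq> Ep z" if "p \<in> set (cnf z)" for p
    using that Ep_terms[of z] by (auto simp: terms_def)
  from assms(1) obtain g j where gj: "g < length (cnf z)"
    "y = \<omega> (cnf_prefix (cnf z) (Suc g) j) \<or> y = \<omega> (cnf_prefix (cnf z) (Suc g) j) \<oplus> olog (fst (cnf z ! g))"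
    unfolding Fcov_oexp[OF assms(2) False] by auto
  have g: "cnf z ! g \<in> set (cnf z)" using gj(1) by simp
  have "Ep (cnf_prefix (cnf z) (Suc g) j) \<subseteq> (\<Union>p\<in>set (take g (cnf z) @ [(fst (cnf z ! g), j)]). Ep (fst p))"
    unfolding cnf_prefix_eq by (rule Ep_wsum)
  also have "\<dots> \<subseteq> Ep z"
  proof
    fix a assume "a \<in> (\<Union>p\<in>set (take g (cnf z) @ [(fst (cnf z ! g), j)]). Ep (fst p))"
    then consider p where "p \<in> set (take g (cnf z))" "a \<in> Ep (fst p)" | "a \<in> Ep (fst (cnf z ! g))" by auto
    then show "a \<in> Ep z"
    proof cases
      case (1 p)
      then show ?thesis using terms[OF in_set_takeD] by blast
    next
      case 2
      then show ?thesis using terms[OF g] by blast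
    qed
  qed
  finally have P: "Ep (cnf_prefix (cnf z) (Suc g) j) \<subseteq> Ep z" .
  obtain v where v: "fst (cnf z ! g) = \<omega> v" using terms_principal[of "fst (cnf z ! g)" z] g by (auto simp: terms_def)
  have "Ep v \<subseteq> Ep z" using terms[OF g] v by simp
  then show ?thesis using gj(2) P v Ep_oadd_subset[of "\<omega> (cnf_prefix (cnf z) (Suc g) j)" v] by auto
qed

lemma Ep_C2:
  assumes "y \<in> C2 (\<sigma>::'a)"
  shows "Ep y \<subseteq> Ep \<sigma>"
proof -
  have terms: "Ep (fst p) \<subseteq> Ep \<sigma>" if "p \<in> set (cnf \<sigma>)" for p
    using that Ep_terms[of \<sigma>] by (auto simp: terms_def)
  from assms consider L l j where "(L, l) \<in> set (cnf \<sigma>)" "y = L \<odot> j" | j where "y = wsum (\<lambda>x. x) (take j (cnf \<sigma>))"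
    unfolding C2_def cnf_val_eq by blast
  then show ?thesis
  proof cases
    case (1 L l j)
    then show ?thesis using Ep_wsum[of "[(L, j)]"] terms[of "(L, l)"] by auto
  next
    case (2 j)
    have "(\<Union>p\<in>set (take j (cnf \<sigma>)). Ep (fst p)) \<subseteq> Ep \<sigma>"
      by (rule UN_least) (rule terms[OF in_set_takeD])
    with 2 show ?thesis using Ep_wsum[of "take j (cnf \<sigma>)"] by blast
  qed
qed

lemma Ep_C1: "y \<in> C1 \<delta> \<Longrightarrow> Ep y \<subseteq> Ep (\<delta>::'a)"
proof -
  assume "y \<in> C1 \<delta>"
  then obtain z where z: "\<omega> z \<in> terms \<delta>" "\<not> is_eps z" "y \<in> Fcov (\<omega> z)" using C1_iff by blast
  have "Ep y \<subseteq> Ep z" using z(3,2) by (rule Ep_Fcov)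
  moreover have "Ep z \<subseteq> Ep \<delta>" using z(1) Ep_oexp[of z] Ep_terms[of \<delta>] by blast
  ultimately show ?thesis by blast
qed

text \<open>Cover sets recombine parts of \<open>\<delta>\<close>, so they introduce no new epsilon
  numbers.\<close>

lemma Ep_Ccov: "y \<in> Ccov \<delta> \<Longrightarrow> Ep y \<subseteq> Ep (\<delta>::'a)"
proof (induction \<delta> rule: less_induct)
  case (less \<delta>)
  from less.prems consider "y \<in> C1 \<delta>" | \<sigma> where "\<sigma> \<in> C1 \<delta>" "y \<in> C2 \<sigma>" | "y \<in> C2 \<delta>"
    | v where "v \<in> Ycov \<delta>" "y \<in> Ccov v" unfolding Ccov_rec[of \<delta>] by blast
  then show ?case
  proof cases
    case 1
    then show ?thesis by (rule Ep_C1)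
  next
    case (2 \<sigma>)
    then show ?thesis using Ep_C1 Ep_C2 by blast
  next
    case 3
    then show ?thesis by (rule Ep_C2)
  next
    case (4 v)
    then show ?thesis using less.IH[OF Ycov_less] Ep_Ycov by blast
  qed
qed

lemma finite_Ccov: "finite (Ccov (\<delta>::'a))"
proof (induction \<delta> rule: less_induct)
  case (less \<delta>)
  have F: "finite (Fcov (\<omega> z))" if "\<not> is_eps z" for z
    using Fcov_one Fcov_oexp[OF that] by (cases "z = \<zero>") auto
  have "finite (\<Union>L\<in>{L \<in> terms \<delta>. \<exists>z. L = \<omega> z \<and> \<not> is_eps z}. Fcov L)"
    by (rule finite_UN_I) (use F in auto)
  moreover have "C1 \<delta> \<subseteq> (\<Union>L\<in>{L \<in> terms \<delta>. \<exists>z. L = \<omega> z \<and> \<not> is_eps z}. Fcov L)"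
    using C1_iff by blast
  ultimately have C1: "finite (C1 \<delta>)" using finite_subset by blast
  have C2: "finite (C2 \<sigma>)" for \<sigma> :: 'a
  proof -
    have "C2 \<sigma> \<subseteq> (\<Union>p\<in>set (cnf \<sigma>). (\<odot>) (fst p) ` {..snd p}) \<union> (\<lambda>j. cnf_val (take j (cnf \<sigma>))) ` {..length (cnf \<sigma>)}"
    proof
      fix y assume "y \<in> C2 \<sigma>"
      then consider L l j where "(L, l) \<in> set (cnf \<sigma>)" "j \<le> l" "y = L \<odot> j"
        | j where "y = cnf_val (take j (cnf \<sigma>))" "j \<le> length (cnf \<sigma>)"
        unfolding C2_def by blast
      then show "y \<in> (\<Union>p\<in>set (cnf \<sigma>). (\<odot>) (fst p) ` {..snd p}) \<union> (\<lambda>j. cnf_val (take j (cnf \<sigma>))) ` {..length (cnf \<sigma>)}"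
      proof cases
        case (1 L l j)
        then have "y \<in> (\<odot>) (fst (L, l)) ` {..snd (L, l)}" by auto
        then show ?thesis using 1(1) by blast
      qed auto
    qed
    then show ?thesis by (rule finite_subset) auto
  qed
  have "Ycov \<delta> \<subseteq> olog ` (\<Union>L\<in>terms \<delta>. terms (olog L))"
    by (auto simp: Ycov_def terms_def)
  then have "finite (Ycov \<delta>)" by (rule finite_subset) auto
  moreover have "finite (Ccov V)" if "V \<in> Ycov \<delta>" for V using less Ycov_less[OF that] .
  ultimately show ?case using C1 C2 unfolding Ccov_rec[of \<delta>] by blast
qed

lemma terms_subset_C2: "terms \<sigma> \<subseteq> C2 \<sigma>"
proof
  fix L assume "L \<in> terms \<sigma>"
  then obtain l where l: "(L, l) \<in> set (cnf \<sigma>)" by (auto simp: terms_def)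
  then have "1 \<le> l" using is_cnf_cnf[of \<sigma>] by (auto simp: is_cnf_def)
  moreover have "L = L \<odot> 1" by simp
  ultimately show "L \<in> C2 \<sigma>" using l unfolding C2_def by blast
qed

lemma self_mem_C2: "\<sigma> \<noteq> \<zero> \<Longrightarrow> \<sigma> \<in> C2 (\<sigma>::'a)"
proof -
  assume "\<sigma> \<noteq> \<zero>"
  then have "cnf \<sigma> \<noteq> []" by (metis wsum_cnf wsum_Nil)
  then have "1 \<le> length (cnf \<sigma>)" by (simp add: Suc_le_eq)
  moreover have "cnf_val (take (length (cnf \<sigma>)) (cnf \<sigma>)) = \<sigma>" by (simp add: cnf_val_eq)
  ultimately show ?thesis unfolding C2_def by (metis (mono_tags, lifting) UnI2 mem_Collect_eq order.refl)
qed

lemma C2_subset_Ccov: "C2 \<sigma> \<subseteq> Ccov (\<sigma>::'a)"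
  by (subst Ccov_rec) blast

text \<open>The point \<alpha>2 belongs to \<open>Dcov\<close> for this purpose:
  \<open>\<alpha> \<lhd> \<alpha> \<oplus> \<alpha>\<close> is transported by \<open>h\<close>, and
  the relation of a point to its double characterises epsilon numbers.\<close>

lemma FB_eps:
  fixes \<alpha> :: 'a
  assumes "is_eps \<alpha>" "B \<inter> {\<alpha>..<next_eps \<alpha>} \<noteq> {}" "h \<in> FB \<alpha> B"
  shows "is_eps (h \<alpha>)" "h \<alpha> < \<alpha>"
proof -
  have D: "\<alpha> \<in> Delta \<alpha> B" "\<alpha> \<oplus> \<alpha> \<in> Delta \<alpha> B"
    using assms(2) by (auto simp: Delta_def Dcov_def numeral_2_eq_2)
  have iso: "iso_plus lt1 (Delta \<alpha> B) h" using assms(3) by (simp add: FB_def)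
  have "\<alpha> \<lhd> \<alpha> \<oplus> \<alpha>" using assms(1) by (rule eps_lt1_double)
  then have "h \<alpha> \<lhd> h (\<alpha> \<oplus> \<alpha>)" using iso_plusD(2)[OF iso D] by blast
  moreover have "h (\<alpha> \<oplus> \<alpha>) = h \<alpha> \<oplus> h \<alpha>" using iso_plusD(3)[OF iso D(1) D(1) D(2)] by simp
  ultimately show "is_eps (h \<alpha>)" using lt1_double_imp_eps by simp
  show "h \<alpha> < \<alpha>" using assms(3) D(1) by (auto simp: FB_def)
qed

end

section \<open>Substitution below the next epsilon number\<close>

locale eps_subst = big_ordinals ty for ty :: "'a::wellorder itself" +
  fixes \<alpha> e :: 'a
  assumes eps_\<alpha>: "is_eps \<alpha>" and eps_e: "is_eps e" and e_less: "e < \<alpha>"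
begin

abbreviation star :: "'a \<Rightarrow> 'a" ("_\<^sup>\<star>" [1000] 1000) where
  "x\<^sup>\<star> \<equiv> subst \<alpha> e x"

text \<open>This is the domain on which the substitution is an embedding. An ordinal containing an
  epsilon number between \<open>e\<close> and \<alpha> could have its order to others reversed when
  \<alpha> drops to \<open>e\<close>.\<close>

definition K :: "'a set" where
  "K = {x. Ep x \<subseteq> insert \<alpha> {..<e}}"

lemma K_zero [simp]: "\<zero> \<in> K"
  by (simp add: K_def)

lemma K_oexp [simp]: "\<omega> x \<in> K \<longleftrightarrow> x \<in> K"
  by (simp add: K_def)

lemma K_oadd: "x \<in> K \<Longrightarrow> y \<in> K \<Longrightarrow> x \<oplus> y \<in> K"
  using Ep_oadd_subset[of x y] by (auto simp: K_def)

lemma K_oadd_right: "x \<oplus> y \<in> K \<Longrightarrow> y \<in> K"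
  using Ep_subset_oadd[of y x] by (auto simp: K_def)

lemma K_terms: "x \<in> K \<longleftrightarrow> terms x \<subseteq> K"
  by (subst K_def) (auto simp: K_def Ep_terms[of x])

lemma K_eps: "x \<in> K \<Longrightarrow> is_eps x \<Longrightarrow> x = \<alpha> \<or> x < e"
  by (auto simp: K_def Ep_eps)

lemma K_less_alpha: "x \<in> K \<Longrightarrow> x < \<alpha> \<Longrightarrow> x < e"
  using Ep_less_imp_less[OF eps_e, of x] Ep_le[of _ x] by (fastforce simp: K_def)

lemma star_oexp [simp]: "(\<omega> x)\<^sup>\<star> = \<omega> (x\<^sup>\<star>)"
  by (rule subst_oexp[OF eps_e])

lemma star_alpha [simp]: "\<alpha>\<^sup>\<star> = e"
  by (simp add: subst_eps eps_\<alpha>)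

lemma star_less_alpha: "x < \<alpha> \<Longrightarrow> x\<^sup>\<star> = x"
  by (rule subst_less[OF eps_e])

lemma star_eq_zero_iff [simp]: "x\<^sup>\<star> = \<zero> \<longleftrightarrow> x = \<zero>"
proof (induction x rule: cnf_induct)
  case (snoc x b)
  then show ?case using subst_snoc[OF eps_e snoc.hyps, where a = \<alpha>] by simp
qed simp

text \<open>Additivity needs monotonicity, to know that absorbed terms stay absorbed, and
  monotonicity needs additivity. Assuming monotonicity only below the exponent \<open>b\<close>
  breaks the circle.\<close>

lemma star_oadd_oexp_aux:
  assumes "\<And>c. c \<in> K \<Longrightarrow> c < b \<Longrightarrow> c\<^sup>\<star> < b\<^sup>\<star>"
  shows "x \<in> K \<Longrightarrow> (x \<oplus> \<omega> b)\<^sup>\<star> = x\<^sup>\<star> \<oplus> \<omega> (b\<^sup>\<star>)"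
proof (induction x rule: cnf_induct)
  case zero
  then show ?case by simp
next
  case (snoc x c)
  have terms: "terms (x \<oplus> \<omega> c) = insert (\<omega> c) (terms x)" using snoc.hyps by (rule terms_snoc)
  show ?case
  proof (cases "b \<le> c")
    case True
    have "\<omega> b \<le> L" if "L \<in> terms (x \<oplus> \<omega> c)" for L
      using that snoc.hyps True unfolding terms by (auto intro: order.trans[of "\<omega> b" "\<omega> c"])
    then show ?thesis by (rule subst_snoc[OF eps_e])
  next
    case False
    have K: "x \<in> K" "c \<in> K" using snoc.prems terms K_terms[of x] K_terms[of "x \<oplus> \<omega> c"] by auto
    have "x \<oplus> \<omega> c \<oplus> \<omega> b = x \<oplus> \<omega> b" using False by (simp add: oadd_assoc oadd_oexp_absorb)
    moreover have "(x \<oplus> \<omega> c)\<^sup>\<star> = x\<^sup>\<star> \<oplus> \<omega> (c\<^sup>\<star>)" by (rule subst_snoc[OF eps_e snoc.hyps])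
    moreover have "\<omega> (c\<^sup>\<star>) \<oplus> \<omega> (b\<^sup>\<star>) = \<omega> (b\<^sup>\<star>)"
      using assms[OF K(2)] False by (intro oadd_oexp_absorb) simp
    ultimately show ?thesis using snoc.IH[OF K(1)] by (simp add: oadd_assoc)
  qed
qed

lemma star_oadd_aux:
  assumes "\<And>b c. \<omega> b \<in> terms y \<Longrightarrow> c \<in> K \<Longrightarrow> c < b \<Longrightarrow> c\<^sup>\<star> < b\<^sup>\<star>" "y \<in> K" "x \<in> K"
  shows "(x \<oplus> y)\<^sup>\<star> = x\<^sup>\<star> \<oplus> y\<^sup>\<star>"
  using assms(1,2)
proof (induction y rule: cnf_induct)
  case zero
  then show ?case by simp
next
  case (snoc y b)
  have terms: "terms (y \<oplus> \<omega> b) = insert (\<omega> b) (terms y)" using snoc.hyps by (rule terms_snoc)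
  have y: "y \<in> K" using snoc.prems(2) terms K_terms[of y] K_terms[of "y \<oplus> \<omega> b"] by auto
  have "(x \<oplus> y \<oplus> \<omega> b)\<^sup>\<star> = (x \<oplus> y)\<^sup>\<star> \<oplus> \<omega> (b\<^sup>\<star>)"
    using snoc.prems(1)[of b] terms by (intro star_oadd_oexp_aux K_oadd y assms(3)) auto
  also have "(x \<oplus> y)\<^sup>\<star> = x\<^sup>\<star> \<oplus> y\<^sup>\<star>"
    using snoc.prems(1) terms by (intro snoc.IH y) auto
  finally show ?case using subst_snoc[OF eps_e snoc.hyps, where a = \<alpha>] by (simp add: oadd_assoc)
qed

text \<open>Write \<open>y = x \<oplus> z\<close>. If \<open>y\<close> is not an epsilon number, the
  exponents of the terms of \<open>z\<close> are below \<open>y\<close>, so the induction hypothesis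
  makes the substitution additive on this sum, and the nonzero image of \<open>z\<close> gives
  strictness. An epsilon number in \<open>K\<close> is \<alpha> or lies below
  \<open>e\<close>.\<close>

lemma star_strict_mono: "x \<in> K \<Longrightarrow> y \<in> K \<Longrightarrow> x < y \<Longrightarrow> x\<^sup>\<star> < y\<^sup>\<star>"
proof (induction y arbitrary: x rule: less_induct)
  case (less y)
  show ?case
  proof (cases "is_eps y")
    case True
    then have "y = \<alpha> \<or> y < e" using K_eps less.prems by blast
    then show ?thesis
    proof
      assume y: "y = \<alpha>"
      then show ?thesis using less.prems K_less_alpha star_less_alpha by simp
    next
      assume "y < e"
      then have "y < \<alpha>" using e_less by (rule order.strict_trans)
      moreover have "x < \<alpha>" using less.prems(3) \<open>y < \<alpha>\<close> by (rule order.strict_trans)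
      ultimately show ?thesis using less.prems(3) by (simp add: star_less_alpha)
    qed
  next
    case False
    obtain z where y: "y = x \<oplus> z" using less.prems(3) le_iff_oadd less_imp_le by blast
    have z: "z \<in> K" using less.prems(2) K_oadd_right unfolding y by blast
    have "c\<^sup>\<star> < b\<^sup>\<star>" if b: "\<omega> b \<in> terms z" and c: "c \<in> K" "c < b" for b c
    proof -
      have "b \<in> K" using b z K_terms[of z] by auto
      have "\<omega> b \<le> y" using terms_le[OF b] le_oadd_right[of z x] unfolding y by (rule order.trans)
      moreover have "b \<noteq> y" using less_oexp_if_not_eps[OF False] \<open>\<omega> b \<le> y\<close> by auto
      moreover have "b \<le> y" using le_oexp \<open>\<omega> b \<le> y\<close> by (rule order.trans)
      ultimately have "b < y" by simp
      then show ?thesis using less.IH c \<open>b \<in> K\<close> by blast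
    qed
    then have "y\<^sup>\<star> = x\<^sup>\<star> \<oplus> z\<^sup>\<star>" unfolding y using z less.prems(1) by (rule star_oadd_aux)
    moreover have "z\<^sup>\<star> \<noteq> \<zero>" using less.prems(3) y by auto
    ultimately show ?thesis by simp
  qed
qed

lemma star_oadd: "x \<in> K \<Longrightarrow> y \<in> K \<Longrightarrow> (x \<oplus> y)\<^sup>\<star> = x\<^sup>\<star> \<oplus> y\<^sup>\<star>"
  using K_terms K_oexp by (intro star_oadd_aux star_strict_mono) blast+

lemma star_less_iff: "x \<in> K \<Longrightarrow> y \<in> K \<Longrightarrow> x\<^sup>\<star> < y\<^sup>\<star> \<longleftrightarrow> x < y"
  using star_strict_mono[of x y] star_strict_mono[of y x] by (cases x y rule: linorder_cases) auto

lemma star_le_iff: "x \<in> K \<Longrightarrow> y \<in> K \<Longrightarrow> x\<^sup>\<star> \<le> y\<^sup>\<star> \<longleftrightarrow> x \<le> y"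
  using star_less_iff[of y x] by (simp flip: not_less)

lemma star_eq_iff: "x \<in> K \<Longrightarrow> y \<in> K \<Longrightarrow> x\<^sup>\<star> = y\<^sup>\<star> \<longleftrightarrow> x = y"
  using star_le_iff[of x y] star_le_iff[of y x] by (auto simp: order.eq_iff)

lemma trailing_term_K:
  assumes "x \<in> K" "x \<noteq> \<zero>"
  obtains y b where "x = y \<oplus> \<omega> b" "y \<in> K" "b \<in> K" "y < x"
proof -
  have "x \<in> K \<longrightarrow> x \<noteq> \<zero> \<longrightarrow> (\<exists>y b. x = y \<oplus> \<omega> b \<and> y \<in> K \<and> b \<in> K)"
  proof (induction x rule: cnf_induct)
    case (snoc y b)
    have "terms (y \<oplus> \<omega> b) = insert (\<omega> b) (terms y)" using snoc.hyps by (rule terms_snoc)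
    then show ?case using K_terms[of "y \<oplus> \<omega> b"] K_terms[of y] by auto
  qed simp
  then show ?thesis using assms that by auto
qed

end

section \<open>Isomorphisms of \<open>\<Delta>(\<alpha>, B)\<close>\<close>

locale delta_iso = eps_subst ty \<alpha> e for ty :: "'a::wellorder itself" and \<alpha> e +
  fixes B :: "'a set" and h :: "'a \<Rightarrow> 'a"
  assumes fin_B: "finite B" and B_bound: "B \<subseteq> {..<next_eps \<alpha>}"
    and B_nonempty: "B \<inter> {\<alpha>..<next_eps \<alpha>} \<noteq> {}"
    and h_FB: "h \<in> FB \<alpha> B" and h_alpha: "h \<alpha> = e"
begin

abbreviation D :: "'a set" where "D \<equiv> Delta \<alpha> B"

lemma Ccov_subset_D: "\<delta> \<in> B \<Longrightarrow> \<alpha> \<le> \<delta> \<Longrightarrow> Ccov \<delta> \<subseteq> D"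
  using B_bound by (auto simp: Delta_def Dcov_def)

lemma alpha_mem_D: "\<alpha> \<in> D"
  using B_nonempty by (auto simp: Delta_def Dcov_def)

lemma D_cases:
  assumes "x \<in> D"
  obtains "x \<in> B" | \<delta> where "\<delta> \<in> B" "\<alpha> \<le> \<delta>" "x \<in> Ccov \<delta>" | "x = \<alpha>" | "x = \<alpha> \<oplus> \<alpha>"
proof -
  have eq: "\<alpha> \<odot> 2 = \<alpha> \<oplus> \<alpha>" by (simp add: numeral_2_eq_2)
  have "x \<in> B \<or> (\<exists>\<delta>\<in>B. \<alpha> \<le> \<delta> \<and> (x \<in> Ccov \<delta> \<or> x = \<alpha> \<or> x = \<alpha> \<oplus> \<alpha>))"
    using assms unfolding Delta_def Dcov_def eq by blast
  with that show ?thesis by blast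
qed

lemma finite_D: "finite D"
  using fin_B finite_Ccov by (auto simp: Delta_def Dcov_def)

lemma iso_h: "iso_plus lt1 D h"
  and h_fixed: "x \<in> D \<Longrightarrow> x < \<alpha> \<Longrightarrow> h x = x"
  using h_FB by (auto simp: FB_def)

lemma h_less_iff: "x \<in> D \<Longrightarrow> y \<in> D \<Longrightarrow> h x < h y \<longleftrightarrow> x < y"
  and h_lt1_iff: "x \<in> D \<Longrightarrow> y \<in> D \<Longrightarrow> h x \<lhd> h y \<longleftrightarrow> x \<lhd> y"
  and h_oadd: "x \<in> D \<Longrightarrow> y \<in> D \<Longrightarrow> x \<oplus> y \<in> D \<Longrightarrow> h (x \<oplus> y) = h x \<oplus> h y"
  using iso_plusD[OF iso_h] by metis+

text \<open>The isomorphism fixes such an \<open>x\<close>, sends \<alpha> to \<open>e\<close> and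
  preserves the order.\<close>

lemma D_less_alpha: "x \<in> D \<Longrightarrow> x < \<alpha> \<Longrightarrow> x < e"
  using h_less_iff[of x \<alpha>] alpha_mem_D h_fixed h_alpha by simp

text \<open>Every epsilon number in \<open>\<delta>\<close> is a term of \<open>\<delta>\<close> or
  occurs in some member of \<open>Ycov \<delta>\<close>. Terms belong to the cover set, hence to
  \<open>D\<close>, where \<open>D_less_alpha\<close> applies; the other case is inductive.\<close>

lemma Ep_below_alpha: "Ccov \<delta> \<subseteq> D \<Longrightarrow> Ep \<delta> \<inter> {..<\<alpha>} \<subseteq> {..<e}"
proof (induction \<delta> rule: less_induct)
  case (less \<delta>)
  have "a < e" if a: "a \<in> Ep \<delta>" "a < \<alpha>" for a
  proof -
    obtain L where L: "L \<in> terms \<delta>" "a \<in> Ep L" using a(1) Ep_terms by blast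
    obtain z where z: "L = \<omega> z" using terms_principal[OF L(1)] by blast
    show ?thesis
    proof (cases "is_eps L")
      case True
      then have "a = L" using L(2) Ep_eps by simp
      moreover have "L \<in> D" using L(1) terms_subset_C2 C2_subset_Ccov less.prems by blast
      ultimately show ?thesis using D_less_alpha a(2) by blast
    next
      case False
      obtain M where M: "M \<in> terms z" "a \<in> Ep M" using L(2) z Ep_terms[of z] by auto
      obtain v where v: "M = \<omega> v" using terms_principal[OF M(1)] by blast
      have Y: "v \<in> Ycov \<delta>" using Ycov_iff L(1) z False M(1) v by auto
      then have "Ccov v \<subseteq> D" using less.prems Ccov_rec[of \<delta>] by blast
      then show ?thesis using less.IH[OF Ycov_less[OF Y]] M(2) v a(2) by auto
    qed
  qed
  then show ?case by blast
qed

lemma D_subset_K: "D \<subseteq> K"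
proof
  \<comment> \<open>Below \<open>next_eps \<alpha>\<close> no epsilon number above \<alpha> can
    occur, so only those below \<alpha> need bounding.\<close>
  have B: "x \<in> K" if x: "x \<in> B" "\<alpha> \<le> x" for x
  proof -
    have "a = \<alpha> \<or> a < e" if a: "a \<in> Ep x" for a
    proof -
      have "a \<le> x" using a by (rule Ep_le)
      also have "x < next_eps \<alpha>" using x(1) B_bound by blast
      finally have "\<not> (is_eps a \<and> \<alpha> < a)" unfolding next_eps_def by (rule not_less_Least)
      then have "a \<le> \<alpha>" using Ep_is_eps[OF a] by simp
      then show ?thesis using Ep_below_alpha[OF Ccov_subset_D[OF x]] a by (cases "a = \<alpha>") auto
    qed
    then show ?thesis by (auto simp: K_def)
  qed
  have \<alpha>: "\<alpha> \<in> K" by (simp add: K_def Ep_eps eps_\<alpha>)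
  fix x assume x: "x \<in> D"
  then show "x \<in> K"
  proof (cases rule: D_cases)
    case 1
    show ?thesis
    proof (cases "x < \<alpha>")
      case True
      then have "x < e" using D_less_alpha x by blast
      then have "Ep x \<subseteq> {..<e}" using Ep_le[of _ x] by (auto intro: order.strict_trans1)
      then show ?thesis by (auto simp: K_def)
    qed (use B 1 in auto)
  next
    case (2 \<delta>)
    then show ?thesis using B[OF 2(1,2)] Ep_Ccov[OF 2(3)] by (auto simp: K_def)
  next
    case 3
    then show ?thesis using \<alpha> by simp
  next
    case 4
    then show ?thesis using \<alpha> K_oadd by simp
  qed
qed

section \<open>The substitution lies below \<open>h\<close>\<close>

lemma star_le_h_if_less: "x \<in> D \<Longrightarrow> x < \<alpha> \<Longrightarrow> x\<^sup>\<star> \<le> h x"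
  by (simp add: star_less_alpha h_fixed)

lemma star_le_h_oadd:
  assumes "x \<in> D" "y \<in> D" "x \<oplus> y \<in> D" "x\<^sup>\<star> \<le> h x" "y\<^sup>\<star> \<le> h y"
  shows "(x \<oplus> y)\<^sup>\<star> \<le> h (x \<oplus> y)"
  using assms D_subset_K by (simp add: star_oadd h_oadd oadd_mono subset_iff)

lemma not_eps_above_alpha: "x \<in> K \<Longrightarrow> \<alpha> < x \<Longrightarrow> \<not> is_eps x"
  using K_eps e_less by (metis less_asym order.strict_trans)

text \<open>The set \<open>C2\<close> contains every intermediate multiple and partial sum. Each
  member thus arises by single additions inside \<open>D\<close>, where \<open>h\<close> and the
  substitution are both additive.\<close>

lemma C2_star_le_h:
  assumes sub: "C2 \<sigma> \<subseteq> D" and terms: "\<And>L. L \<in> terms \<sigma> \<Longrightarrow> L\<^sup>\<star> \<le> h L" and y: "y \<in> C2 \<sigma>"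
  shows "y\<^sup>\<star> \<le> h y"
proof -
  define zs where "zs = cnf \<sigma>"
  have mult: "L \<odot> Suc j \<in> D \<and> (L \<odot> Suc j)\<^sup>\<star> \<le> h (L \<odot> Suc j)" if "(L, l) \<in> set zs" "Suc j \<le> l" for L l j
  proof -
    have mem: "L \<odot> Suc i \<in> D" if "Suc i \<le> l" for i
    proof -
      have "1 \<le> Suc i" by simp
      then show ?thesis using sub \<open>(L, l) \<in> set zs\<close> that unfolding C2_def zs_def by blast
    qed
    have L: "L \<in> terms \<sigma>" using \<open>(L, l) \<in> set zs\<close> by (force simp: terms_def zs_def)
    have "(L \<odot> Suc j)\<^sup>\<star> \<le> h (L \<odot> Suc j)" using \<open>Suc j \<le> l\<close>
    proof (induction j)
      case 0
      then show ?case using terms[OF L] by simp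
    next
      case (Suc j)
      have "L \<in> D" using mem[of 0] Suc.prems by simp
      then have "(L \<odot> Suc j \<oplus> L)\<^sup>\<star> \<le> h (L \<odot> Suc j \<oplus> L)"
        using Suc mem[of j] mem[of "Suc j"] terms[OF L] by (intro star_le_h_oadd) auto
      then show ?case by simp
    qed
    then show ?thesis using mem that by blast
  qed
  have full: "fst p \<odot> snd p \<in> D \<and> (fst p \<odot> snd p)\<^sup>\<star> \<le> h (fst p \<odot> snd p)" if "p \<in> set zs" for p
  proof -
    have "0 < snd p" using that is_cnf_cnf[of \<sigma>] by (simp add: is_cnf_def zs_def)
    then obtain j where "snd p = Suc j" using gr0_implies_Suc by blast
    then show ?thesis using mult[of "fst p" "snd p" j] that unfolding prod.collapse by simp
  qed
  have sums: "wsum (\<lambda>x. x) (take (Suc j) zs) \<in> D \<and> (wsum (\<lambda>x. x) (take (Suc j) zs))\<^sup>\<star> \<le> h (wsum (\<lambda>x. x) (take (Suc j) zs))"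
    if "j < length zs" for j
    using that
  proof (induction j)
    case 0
    then have "take (Suc 0) zs = [zs ! 0]" by (simp add: take_Suc_conv_app_nth)
    then show ?case using full[of "zs ! 0"] 0 by simp
  next
    case (Suc j)
    have "1 \<le> Suc (Suc j)" "Suc (Suc j) \<le> length (cnf \<sigma>)" using Suc.prems by (simp_all add: zs_def)
    then have mem: "wsum (\<lambda>x. x) (take (Suc (Suc j)) zs) \<in> D"
      using sub unfolding C2_def cnf_val_eq zs_def by blast
    have eq: "wsum (\<lambda>x. x) (take (Suc (Suc j)) zs)
        = wsum (\<lambda>x. x) (take (Suc j) zs) \<oplus> fst (zs ! Suc j) \<odot> snd (zs ! Suc j)"
      using Suc.prems by (simp add: take_Suc_conv_app_nth[of "Suc j"])
    show ?case
      using mem star_le_h_oadd[of "wsum (\<lambda>x. x) (take (Suc j) zs)" "fst (zs ! Suc j) \<odot> snd (zs ! Suc j)"]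
        Suc full[of "zs ! Suc j"] unfolding eq by simp
  qed
  from y consider L l j where "(L, l) \<in> set zs" "1 \<le> j" "j \<le> l" "y = L \<odot> j"
    | j where "1 \<le> j" "j \<le> length zs" "y = wsum (\<lambda>x. x) (take j zs)"
    unfolding C2_def cnf_val_eq zs_def by blast
  then show ?thesis
  proof cases
    case (1 L l j)
    then show ?thesis using mult[of L l "j - 1"] by simp
  next
    case (2 j)
    then show ?thesis using sums[of "j - 1"] by simp
  qed
qed

text \<open>Here \<open>u\<close> is \<open><\<^sub>1\<close>-connected to \<open>u \<oplus> v\<close> exactly because \<open>v\<close> is the last
  exponent in the exponent of \<open>u\<close>. The isomorphism transports this, so the exponent of \<open>h u\<close> must end
  in an exponent that is at least \<open>h v\<close>.\<close>

lemma oexp_star_le_h_step: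
  assumes u: "u = \<omega> (p \<oplus> \<omega> v)" "u \<in> D" "u \<oplus> v \<in> D"
    and v: "v = \<zero> \<or> v \<in> D \<and> v\<^sup>\<star> \<le> h v"
    and p: "p = \<zero> \<or> \<omega> p \<in> D \<and> (\<omega> p)\<^sup>\<star> \<le> h (\<omega> p)"
  shows "u\<^sup>\<star> \<le> h u"
proof (cases u \<alpha> rule: linorder_cases)
  case less
  then show ?thesis using u(2) star_le_h_if_less by blast
next
  case equal
  then show ?thesis by (simp add: h_alpha)
next
  case greater
  have uK: "p \<oplus> \<omega> v \<in> K" using u(1,2) D_subset_K by auto
  then have vK: "v \<in> K" using K_oadd_right K_oexp by blast
  have pK: "p \<in> K" using p D_subset_K by auto
  have star_u: "u\<^sup>\<star> = \<omega> (p\<^sup>\<star> \<oplus> \<omega> (v\<^sup>\<star>))" using u(1) pK vK by (simp add: star_oadd)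
  \<comment> \<open>No epsilon number of \<open>K\<close> lies above \<alpha>, so the exponent of
    \<open>u\<close>, and with it \<open>v\<close>, is below \<open>u\<close>. This later yields
    \<open>h v < h u\<close>, as required by \<open>lt1_oadd_bound\<close>.\<close>
  have "\<not> is_eps (p \<oplus> \<omega> v)" using not_eps_above_alpha[of u] greater u D_subset_K by auto
  then have "p \<oplus> \<omega> v < u" using less_oexp_if_not_eps u(1) by blast
  moreover have "v \<le> p \<oplus> \<omega> v" by (rule order.trans[OF le_oexp le_oadd_right])
  ultimately have "v < u" by (rule order.strict_trans1[rotated])
  have "\<omega> p < u" using u(1) by simp
  show ?thesis
  \<comment> \<open>For \<open>v = \<zero>\<close> the relation \<open>lt1\<close> says nothing
    about \<open>u\<close> and \<open>u \<oplus> v\<close>. The transported sum is then the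
    absorption of \<open>\<omega> p\<close> by \<open>u\<close>.\<close>
  proof (cases "v = \<zero>")
    case True
    then have u': "u = \<omega> (osucc p)" using u(1) by (simp add: oexp_zero)
    have "p \<noteq> \<zero>"
    proof
      assume "p = \<zero>"
      then have "\<omega> \<alpha> < \<omega> (osucc \<zero>)" using greater u' eps_\<alpha> by (simp add: is_eps_def)
      then have "\<alpha> = \<zero>" by simp
      then show False using eps_\<alpha> by simp
    qed
    then have p': "\<omega> p \<in> D" "(\<omega> p)\<^sup>\<star> \<le> h (\<omega> p)" using p by auto
    have absorb: "\<omega> p \<oplus> u = u" using \<open>\<omega> p < u\<close> u(1) oadd_oexp_absorb by blast
    then have "h (\<omega> p) \<oplus> h u = h u" using h_oadd[OF p'(1) u(2)] u(2) by simp
    moreover have "\<omega> (p\<^sup>\<star>) \<le> h (\<omega> p)" using p'(2) by simp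
    ultimately have "\<omega> (osucc (p\<^sup>\<star>)) \<le> h u" by (rule oexp_osucc_le_if_absorbed[rotated])
    then show ?thesis using True star_u by (simp add: oexp_zero)
  next
    case False
    then have v': "v \<in> D" "v\<^sup>\<star> \<le> h v" using v by auto
    have "u \<lhd> u \<oplus> v" using le1_oexp_oadd[of v v p] False u(1) by (simp add: le1_def)
    then have lt1: "h u \<lhd> h u \<oplus> h v"
      using h_lt1_iff[OF u(2,3)] h_oadd[OF u(2) v'(1) u(3)] by simp
    obtain q w where q: "h u = \<omega> (q \<oplus> \<omega> w)" using lt1_imp_oexp[OF lt1] .
    have "h v < h u" using h_less_iff[OF v'(1) u(2)] \<open>v < u\<close> by simp
    then have "h v \<le> w" using lt1_oadd_bound[of q w "h v"] lt1 q by simp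
    then have "v\<^sup>\<star> \<le> w" using v'(2) by (rule order.trans[rotated])
    have "p\<^sup>\<star> < q \<oplus> \<omega> w"
    proof (cases "p = \<zero>")
      case True
      then show ?thesis by (simp add: ozero_less_iff)
    next
      case False
      then have "\<omega> (p\<^sup>\<star>) \<le> h (\<omega> p)" "h (\<omega> p) < h u"
        using p h_less_iff[of "\<omega> p" u] u(2) \<open>\<omega> p < u\<close> by simp_all
      then have "\<omega> (p\<^sup>\<star>) < h u" by (rule order.strict_trans1)
      then show ?thesis using q by simp
    qed
    \<comment> \<open>The bounds on the two parts are combined here: the exponent of
      \<open>h u\<close> exceeds the image of \<open>p\<close> and ends in
      \<open>\<omega> w\<close>, so it also leaves room for \<open>\<omega> w\<close> after that
      image.\<close>
    then have "p\<^sup>\<star> \<oplus> \<omega> w \<le> q \<oplus> \<omega> w" by (rule oadd_trailing_le)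
    moreover have "p\<^sup>\<star> \<oplus> \<omega> (v\<^sup>\<star>) \<le> p\<^sup>\<star> \<oplus> \<omega> w" using \<open>v\<^sup>\<star> \<le> w\<close> by simp
    ultimately have "p\<^sup>\<star> \<oplus> \<omega> (v\<^sup>\<star>) \<le> q \<oplus> \<omega> w" by (rule order.trans[rotated])
    then show ?thesis using star_u q by simp
  qed
qed

text \<open>The elements of \<open>Fcov\<close> are the powers of successive prefixes of
  \<open>z\<close>, each with its trailing exponent added. Thus \<open>oexp_star_le_h_step\<close>
  applies along the prefixes, the bound for one being the hypothesis \<open>p\<close> for the
  next.\<close>

lemma Fcov_star_le_h:
  assumes z: "\<not> is_eps z" and sub: "Fcov (\<omega> z) \<subseteq> D" and y: "y \<in> Fcov (\<omega> z)"
    and exps: "\<And>v. \<omega> v \<in> terms z \<Longrightarrow> v = \<zero> \<or> v \<in> D \<and> v\<^sup>\<star> \<le> h v"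
  shows "y\<^sup>\<star> \<le> h y"
proof (cases "z = \<zero>")
  case True
  have "\<alpha> \<noteq> \<zero>" using eps_\<alpha> by auto
  then have "\<omega> \<zero> < \<omega> \<alpha>" by (simp add: ozero_less_iff)
  then have "\<omega> \<zero> < \<alpha>" using eps_\<alpha> unfolding is_eps_def by simp
  moreover have "y = \<omega> \<zero>" using True y Fcov_one by simp
  ultimately show ?thesis using star_le_h_if_less y sub by blast
next
  case False
  define zs where "zs = cnf z"
  note F = Fcov_oexp[OF z False, folded zs_def]
  define pre where "pre g j = cnf_prefix zs (Suc g) j" for g j
  have mem: "\<omega> (pre g j) \<in> D" "\<omega> (pre g j) \<oplus> olog (fst (zs ! g)) \<in> D"
    if "g < length zs" "1 \<le> j" "j \<le> snd (zs ! g)" for g j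
  proof -
    have "g \<in> {..<length zs}" "j \<in> {1..snd (zs ! g)}" using that by auto
    then show "\<omega> (pre g j) \<in> D" "\<omega> (pre g j) \<oplus> olog (fst (zs ! g)) \<in> D"
      using sub unfolding F pre_def by blast+
  qed
  have exp: "\<exists>v. fst (zs ! g) = \<omega> v \<and> (v = \<zero> \<or> v \<in> D \<and> v\<^sup>\<star> \<le> h v)" if "g < length zs" for g
  proof -
    have "fst (zs ! g) \<in> terms z" using that by (simp add: terms_def zs_def)
    then show ?thesis using terms_principal exps by metis
  qed
  have step: "\<omega> (pre g (Suc j)) \<in> D \<and> (\<omega> (pre g (Suc j)))\<^sup>\<star> \<le> h (\<omega> (pre g (Suc j)))"
    if g: "g < length zs" "Suc j \<le> snd (zs ! g)"
      and p: "pre g j = \<zero> \<or> \<omega> (pre g j) \<in> D \<and> (\<omega> (pre g j))\<^sup>\<star> \<le> h (\<omega> (pre g j))" for g j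
  proof -
    obtain v where v: "fst (zs ! g) = \<omega> v" "v = \<zero> \<or> v \<in> D \<and> v\<^sup>\<star> \<le> h v" using exp[OF g(1)] by blast
    have eq: "\<omega> (pre g (Suc j)) = \<omega> (pre g j \<oplus> \<omega> v)" by (simp add: pre_def cnf_prefix_Suc v(1))
    have m: "\<omega> (pre g (Suc j)) \<in> D" "\<omega> (pre g (Suc j)) \<oplus> v \<in> D"
      using mem[OF g(1) _ g(2)] v(1) by simp_all
    show ?thesis using oexp_star_le_h_step[OF eq m v(2) p] m(1) by blast
  qed
  \<comment> \<open>Outer induction on the entry, inner induction on the count. At count zero the
    prefix is empty or equals the full prefix of the preceding entry.\<close>
  have bound: "pre g j = \<zero> \<or> \<omega> (pre g j) \<in> D \<and> (\<omega> (pre g j))\<^sup>\<star> \<le> h (\<omega> (pre g j))"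
    if "g < length zs" "j \<le> snd (zs ! g)" for g j
    using that
  proof (induction g arbitrary: j)
    case 0
    note g = 0(1)
    from 0(2) show ?case
    proof (induction j)
      case 0
      show ?case by (simp add: pre_def cnf_prefix_zero)
    next
      case (Suc j)
      then show ?case using step[OF g Suc.prems] by simp
    qed
  next
    case (Suc g)
    note g = Suc.prems(1)
    from Suc.prems(2) show ?case
    proof (induction j)
      case 0
      have "pre (Suc g) 0 = pre g (snd (zs ! g))" using g by (simp add: pre_def cnf_prefix_next)
      then show ?case using Suc.IH[of "snd (zs ! g)"] g by simp
    next
      case (Suc j)
      then show ?case using step[OF g Suc.prems] by simp
    qed
  qed
  obtain g j where gj: "g < length zs" "1 \<le> j" "j \<le> snd (zs ! g)"
    "y = \<omega> (pre g j) \<or> y = \<omega> (pre g j) \<oplus> olog (fst (zs ! g))"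
    using y unfolding F pre_def by auto
  obtain j' where j': "j = Suc j'" using gj(2) by (cases j) auto
  have b: "\<omega> (pre g j) \<in> D" "(\<omega> (pre g j))\<^sup>\<star> \<le> h (\<omega> (pre g j))"
    using step[OF gj(1), of j'] bound[OF gj(1), of j'] gj(3) j' by auto
  obtain v where v: "fst (zs ! g) = \<omega> v" "v = \<zero> \<or> v \<in> D \<and> v\<^sup>\<star> \<le> h v" using exp[OF gj(1)] by blast
  from gj(4) show ?thesis
  proof
    assume "y = \<omega> (pre g j) \<oplus> olog (fst (zs ! g))"
    then have "y = \<omega> (pre g j) \<oplus> v" "\<omega> (pre g j) \<oplus> v \<in> D" using v(1) mem(2)[OF gj(1,2,3)] by simp_all
    then show ?thesis using v(2) b star_le_h_oadd[of "\<omega> (pre g j)" v] by auto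
  qed (use b in simp)
qed

text \<open>The order of the parts matters: the exponents in \<open>Ycov\<close> come from the
  induction hypothesis, they give the bound on \<open>Fcov\<close>, this gives the terms of
  \<open>\<delta>\<close> and of the members of \<open>C1\<close>, and sums of terms give the
  \<open>C2\<close> parts.\<close>

lemma Ccov_star_le_h: "Ccov \<delta> \<subseteq> D \<Longrightarrow> y \<in> Ccov \<delta> \<Longrightarrow> y\<^sup>\<star> \<le> h y"
proof (induction \<delta> arbitrary: y rule: less_induct)
  case (less \<delta>)
  have sub: "C1 \<delta> \<subseteq> D" "\<And>\<sigma>. \<sigma> \<in> C1 \<delta> \<Longrightarrow> C2 \<sigma> \<subseteq> D" "C2 \<delta> \<subseteq> D" "\<And>v. v \<in> Ycov \<delta> \<Longrightarrow> Ccov v \<subseteq> D"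
    using less.prems(1) Ccov_rec[of \<delta>] by blast+
  have Y: "w\<^sup>\<star> \<le> h w" if "v \<in> Ycov \<delta>" "w \<in> Ccov v" for v w
    using less.IH[OF Ycov_less[OF that(1)] sub(4)[OF that(1)] that(2)] .
  have exps: "v = \<zero> \<or> v \<in> D \<and> v\<^sup>\<star> \<le> h v" if "v \<in> Ycov \<delta>" for v
    using self_mem_C2[of v] C2_subset_Ccov[of v] Y[OF that] sub(4)[OF that] by blast
  have exp_terms: "L \<in> D \<and> L\<^sup>\<star> \<le> h L" if "v \<in> Ycov \<delta>" "L \<in> terms v" for v L
    using terms_subset_C2[of v] C2_subset_Ccov[of v] Y[OF that(1)] sub(4)[OF that(1)] that(2) by blast
  have F: "y\<^sup>\<star> \<le> h y" if z: "\<omega> z \<in> terms \<delta>" "\<not> is_eps z" and y: "y \<in> Fcov (\<omega> z)" for y z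
  proof (rule Fcov_star_le_h[OF z(2) _ y])
    show "Fcov (\<omega> z) \<subseteq> D" using sub(1) C1_iff z by blast
    show "v = \<zero> \<or> v \<in> D \<and> v\<^sup>\<star> \<le> h v" if "\<omega> v \<in> terms z" for v
      using exps Ycov_iff z that by blast
  qed
  have C1: "y\<^sup>\<star> \<le> h y" if "y \<in> C1 \<delta>" for y
    using that F C1_iff by blast
  \<comment> \<open>A term of such a \<sigma> is the power of a prefix, already bounded, or a term
    of an exponent in \<open>Ycov \<delta>\<close>, which lies in the cover set of that
    exponent.\<close>
  have terms_F: "L\<^sup>\<star> \<le> h L" if z: "\<omega> z \<in> terms \<delta>" "\<not> is_eps z" and \<sigma>: "\<sigma> \<in> Fcov (\<omega> z)" and L: "L \<in> terms \<sigma>" for z \<sigma> L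
  proof (cases "z = \<zero>")
    case True
    then have "L = \<sigma>" using \<sigma> L Fcov_one by simp
    then show ?thesis using F[OF z \<sigma>] by simp
  next
    case False
    obtain g j where gj: "g < length (cnf z)" "1 \<le> j" "j \<le> snd (cnf z ! g)"
      "\<sigma> = \<omega> (cnf_prefix (cnf z) (Suc g) j) \<or> \<sigma> = \<omega> (cnf_prefix (cnf z) (Suc g) j) \<oplus> olog (fst (cnf z ! g))"
      using \<sigma> unfolding Fcov_oexp[OF z(2) False] by auto
    have "g \<in> {..<length (cnf z)}" "j \<in> {1..snd (cnf z ! g)}" using gj by auto
    then have mem: "\<omega> (cnf_prefix (cnf z) (Suc g) j) \<in> Fcov (\<omega> z)"
      unfolding Fcov_oexp[OF z(2) False] by blast
    have "fst (cnf z ! g) \<in> terms z" using gj(1) by (simp add: terms_def)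
    moreover obtain v where v: "fst (cnf z ! g) = \<omega> v" using terms_principal calculation by blast
    ultimately have Yv: "v \<in> Ycov \<delta>" using Ycov_iff z by auto
    have "terms \<sigma> \<subseteq> insert (\<omega> (cnf_prefix (cnf z) (Suc g) j)) (terms v)"
      using gj(4) v terms_oadd_subset[of "\<omega> (cnf_prefix (cnf z) (Suc g) j)" v] by auto
    then show ?thesis using L F[OF z mem] exp_terms[OF Yv] by blast
  qed
  have terms_\<delta>: "L\<^sup>\<star> \<le> h L" if L: "L \<in> terms \<delta>" for L
  proof -
    have LD: "L \<in> D" using L terms_subset_C2 sub(3) by blast
    obtain z where z: "L = \<omega> z" using terms_principal[OF L] by blast
    show ?thesis
    proof (cases "is_eps z")
      case True
      then have "is_eps L" using z by simp
      then have "L = \<alpha> \<or> L < \<alpha>" using K_eps D_subset_K LD e_less by (meson order.strict_trans subsetD)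
      then show ?thesis
      proof
        assume "L = \<alpha>"
        then show ?thesis by (simp add: h_alpha)
      qed (rule star_le_h_if_less[OF LD])
    next
      case False
      \<comment> \<open>A non-epsilon term is the power of its last full prefix, so it occurs in its
        own \<open>Fcov\<close> set.\<close>
      have "L \<in> Fcov (\<omega> z)"
      proof (cases "z = \<zero>")
        case True
        then show ?thesis using Fcov_one z by simp
      next
        case nz: False
        define g where "g = length (cnf z) - 1"
        have "cnf z \<noteq> []" using nz by (metis wsum_cnf wsum_Nil)
        then have g: "g < length (cnf z)" "Suc g = length (cnf z)" by (simp_all add: g_def)
        then have "0 < snd (cnf z ! g)" using is_cnf_cnf[of z] by (simp add: is_cnf_def)
        then have j: "g \<in> {..<length (cnf z)}" "snd (cnf z ! g) \<in> {1..snd (cnf z ! g)}" using g(1) by auto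
        have "cnf_prefix (cnf z) (Suc g) (snd (cnf z ! g)) = z"
          using cnf_prefix_full[OF g(1)] g(2) by simp
        then have "L \<in> {\<omega> (cnf_prefix (cnf z) (Suc g) (snd (cnf z ! g))),
            \<omega> (cnf_prefix (cnf z) (Suc g) (snd (cnf z ! g))) \<oplus> olog (fst (cnf z ! g))}" using z by simp
        then show ?thesis unfolding Fcov_oexp[OF False nz]
          by - (rule UN_I[OF j(1)], rule UN_I[OF j(2)], assumption)
      qed
      then show ?thesis using F[of z L] L z False by simp
    qed
  qed
  from less.prems(2) consider "y \<in> C1 \<delta>" | \<sigma> where "\<sigma> \<in> C1 \<delta>" "y \<in> C2 \<sigma>" | "y \<in> C2 \<delta>"
    | v where "v \<in> Ycov \<delta>" "y \<in> Ccov v" unfolding Ccov_rec[of \<delta>] by blast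
  then show ?case
  proof cases
    case 1
    then show ?thesis by (rule C1)
  next
    case (2 \<sigma>)
    then obtain z where "\<omega> z \<in> terms \<delta>" "\<not> is_eps z" "\<sigma> \<in> Fcov (\<omega> z)" using C1_iff by blast
    then show ?thesis using C2_star_le_h[OF sub(2)[OF 2(1)] _ 2(2)] terms_F by blast
  next
    case 3
    show ?thesis using sub(3) terms_\<delta> 3 by (rule C2_star_le_h)
  next
    case (4 v)
    then show ?thesis by (rule Y)
  qed
qed

lemma star_le_h:
  assumes "x \<in> D"
  shows "x\<^sup>\<star> \<le> h x"
proof (cases "x < \<alpha>")
  case True
  then show ?thesis using assms star_le_h_if_less by blast
next
  case False
  from assms show ?thesis
  proof (cases rule: D_cases)
    case 1
    then have "x \<in> Ccov x" using self_mem_C2[of x] C2_subset_Ccov False eps_\<alpha> by (metis not_is_eps_zero not_less_ozero not_le subsetD le_ozero_iff not_less)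
    then show ?thesis using Ccov_star_le_h[OF Ccov_subset_D[OF 1]] False by simp
  next
    case (2 \<delta>)
    then show ?thesis using Ccov_star_le_h[OF Ccov_subset_D[OF 2(1,2)]] by simp
  next
    case 3
    then show ?thesis by (simp add: h_alpha)
  next
    case 4
    then show ?thesis using star_le_h_oadd[OF alpha_mem_D alpha_mem_D] assms by (simp add: h_alpha)
  qed
qed

text \<open>The position of \<open>x\<close> decides the method. Below or at \<alpha>, the
  isomorphism \<open>h\<close> and the connection of \<alpha> to the maximum are used; above
  \<alpha>, the explicit description of \<open>lt1\<close> suffices.\<close>

lemma star_lt1_iff:
  assumes max: "\<alpha> \<unlhd> Max D" and xy: "x \<in> D" "y \<in> D"
  shows "x\<^sup>\<star> \<lhd> y\<^sup>\<star> \<longleftrightarrow> x \<lhd> y"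
proof (cases "x < y")
  case False
  then have "\<not> x\<^sup>\<star> < y\<^sup>\<star>" using star_less_iff xy D_subset_K by blast
  then show ?thesis using False lt1_less by blast
next
  case True
  have K: "x \<in> K" "y \<in> K" using xy D_subset_K by auto
  have y_max: "y \<le> Max D" using finite_D xy(2) by simp
  show ?thesis
  proof (cases x \<alpha> rule: linorder_cases)
    case less
    then have xe: "x < e" using D_less_alpha xy by blast
    show ?thesis
    proof (cases "y < \<alpha>")
      case True
      then show ?thesis using less by (simp add: star_less_alpha)
    next
      case False
      have e_le: "e \<le> y\<^sup>\<star>" using star_le_iff[of \<alpha> y] K alpha_mem_D D_subset_K False by auto
      \<comment> \<open>Cut down to \<open>e = h \<alpha>\<close>, pull back along \<open>h\<close>
        to \<alpha>, and climb to the maximum of \<open>D\<close> by transitivity.\<close>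
      have "x \<lhd> y" if "x \<lhd> y\<^sup>\<star>"
      proof -
        have "x \<lhd> e" using that xe e_le by (rule lt1_downward)
        then have "h x \<lhd> h \<alpha>" using h_fixed[OF xy(1) less] h_alpha by simp
        then have "x \<lhd> \<alpha>" using h_lt1_iff[OF xy(1) alpha_mem_D] by simp
        then have "x \<lhd> Max D" using max lt1_trans by (auto simp: le1_def)
        then show ?thesis using True y_max by (rule lt1_downward)
      qed
      \<comment> \<open>The image of \<open>y\<close> is at most
        \<open>h y < \<alpha> \<le> y\<close>, so downward closure suffices.\<close>
      moreover have "x \<lhd> y\<^sup>\<star>" if "x \<lhd> y"
      proof (rule lt1_downward[OF that])
        show "x < y\<^sup>\<star>" using xe e_le by (rule order.strict_trans2)
        have "h y < \<alpha>" using h_FB xy(2) by (auto simp: FB_def)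
        then show "y\<^sup>\<star> \<le> y" using star_le_h[OF xy(2)] False by simp
      qed
      ultimately show ?thesis using less by (auto simp: star_less_alpha)
    qed
  next
    case equal
    have "\<alpha> \<lhd> y"
    proof (cases "\<alpha> = Max D")
      case True
      then show ?thesis using y_max equal \<open>x < y\<close> by simp
    next
      case False
      then have "\<alpha> \<lhd> Max D" using max by (simp add: le1_def)
      then show ?thesis using \<open>x < y\<close> equal y_max lt1_downward by blast
    qed
    \<comment> \<open>The isomorphism gives a connection of \<open>e\<close> to \<open>h y\<close>.
      The image of \<open>y\<close> under the substitution lies above \<open>e\<close> and at most
      at \<open>h y\<close>, so it is connected as well.\<close>
    moreover have "h \<alpha> \<lhd> h y" using h_lt1_iff[OF alpha_mem_D xy(2)] calculation by simp
    then have "e \<lhd> y\<^sup>\<star>"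
      using star_le_h[OF xy(2)] star_strict_mono[OF K True] equal h_alpha by (auto intro: lt1_downward)
    ultimately show ?thesis using equal by simp
  next
    case greater
    show ?thesis
    proof (cases "\<exists>c. x = \<omega> c")
      case True
      then obtain c where c: "x = \<omega> c" by blast
      have cK: "c \<in> K" using c K(1) by simp
      have eps: "\<not> is_eps c" using not_eps_above_alpha[OF K(1) greater] c by simp
      have "c \<noteq> \<zero>"
      proof
        assume "c = \<zero>"
        then have "\<omega> \<alpha> < \<omega> \<zero>" using greater c eps_\<alpha> by (simp add: is_eps_def)
        then show False by simp
      qed
      then obtain z v where zv: "c = z \<oplus> \<omega> v" "z \<in> K" "v \<in> K" using trailing_term_K[OF cK] by metis
      have "v < x"
      proof -
        have "v \<le> c" unfolding zv(1) by (rule order.trans[OF le_oexp le_oadd_right])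
        also have "c < x" using less_oexp_if_not_eps[OF eps] c by simp
        finally show ?thesis .
      qed
      have x: "x = \<omega> (z \<oplus> \<omega> v)" using c zv(1) by simp
      have x_star: "x\<^sup>\<star> = \<omega> (z\<^sup>\<star> \<oplus> \<omega> (v\<^sup>\<star>))" using x zv by (simp add: star_oadd)
      have "x \<lhd> y \<longleftrightarrow> x < y \<and> y \<le> x \<oplus> v"
        using lt1_oexp_iff[of v z y] \<open>v < x\<close> x by simp
      \<comment> \<open>The inequality \<open>v < x\<close> survives the substitution, so the image
        of \<open>x\<close> is again a non-epsilon power and both sides are described by the same
        interval.\<close>
      moreover have "v\<^sup>\<star> < x\<^sup>\<star>" using star_strict_mono zv(3) K(1) \<open>v < x\<close> by blast
      then have "x\<^sup>\<star> \<lhd> y\<^sup>\<star> \<longleftrightarrow> x\<^sup>\<star> < y\<^sup>\<star> \<and> y\<^sup>\<star> \<le> x\<^sup>\<star> \<oplus> v\<^sup>\<star>"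
        using lt1_oexp_iff[of "v\<^sup>\<star>" "z\<^sup>\<star>" "y\<^sup>\<star>"] x_star by simp
      moreover have "x\<^sup>\<star> \<oplus> v\<^sup>\<star> = (x \<oplus> v)\<^sup>\<star>" using star_oadd K(1) zv(3) by simp
      ultimately show ?thesis using star_less_iff[OF K] star_le_iff[OF K(2) K_oadd[OF K(1) zv(3)]] by simp
    next
      case False
      have "\<zero> < x" using greater by (rule order.strict_trans1[OF ozero_le])
      then obtain z b where zb: "x = z \<oplus> \<omega> b" "z \<in> K" "b \<in> K"
        using trailing_term_K[OF K(1)] by (metis less_irrefl)
      have "z \<noteq> \<zero>" using zb(1) False by auto
      have "\<omega> b \<noteq> x" using False by blast
      moreover have "\<omega> b \<le> x" unfolding zb(1) by (rule le_oadd_right)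
      ultimately have "\<omega> b < x" by simp
      have "z < x" using zb(1) by simp
      have star: "z\<^sup>\<star> < x\<^sup>\<star>" "(\<omega> b)\<^sup>\<star> < x\<^sup>\<star>"
        using star_strict_mono[OF _ K(1)] zb \<open>z < x\<close> \<open>\<omega> b < x\<close> K_oexp by blast+
      have x_star: "x\<^sup>\<star> = z\<^sup>\<star> \<oplus> (\<omega> b)\<^sup>\<star>" using zb by (simp add: star_oadd)
      \<comment> \<open>The image of \<open>x\<close> is a sum of two smaller ordinals, hence not a
        power. Neither \<open>x\<close> nor its image can start a \<open>lt1\<close> pair.\<close>
      have "x\<^sup>\<star> \<noteq> \<omega> c" for c
      proof
        assume "x\<^sup>\<star> = \<omega> c"
        then have "z\<^sup>\<star> \<oplus> (\<omega> b)\<^sup>\<star> < x\<^sup>\<star>" using star oadd_less_oexp by metis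
        then show False using x_star by simp
      qed
      then have "\<not> x\<^sup>\<star> \<lhd> y\<^sup>\<star>" using lt1_imp_oexp by blast
      moreover have "\<not> x \<lhd> y" using False lt1_imp_oexp by blast
      ultimately show ?thesis by blast
    qed
  qed
qed

lemma iso_plus_omega_star:
  assumes "\<alpha> \<unlhd> Max D"
  shows "iso_plus_omega D (\<lambda>x. x\<^sup>\<star>)"
proof -
  have K: "x \<in> K" if "x \<in> D" for x using that D_subset_K by blast
  have "inj_on (\<lambda>x. x\<^sup>\<star>) D" using K star_eq_iff by (simp add: inj_on_def)
  moreover have "x \<oplus> y = z \<longleftrightarrow> x\<^sup>\<star> \<oplus> y\<^sup>\<star> = z\<^sup>\<star>" if "x \<in> D" "y \<in> D" "z \<in> D" for x y z
    using that K star_oadd star_eq_iff K_oadd by metis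
  moreover have "\<omega> x = y \<longleftrightarrow> \<omega> (x\<^sup>\<star>) = y\<^sup>\<star>" if "x \<in> D" "y \<in> D" for x y
    using that K star_oexp star_eq_iff K_oexp by metis
  ultimately show ?thesis
    unfolding iso_plus_omega_def iso_plus_def
    using K star_less_iff star_lt1_iff[OF assms] by simp
qed

end

theorem mainTheorem7:
  fixes \<alpha> :: "'a::wellorder" and B :: "'a set" and h :: "'a \<Rightarrow> 'a"
  assumes big: "big_ordinal_type TYPE('a)"
    and eps: "is_eps \<alpha>"
    and finB: "finite B"
    and Bsub: "B \<subseteq> {..<next_eps \<alpha>}"
    and Bne: "B \<inter> {\<alpha>..<next_eps \<alpha>} \<noteq> {}"
    and hFB: "h \<in> FB \<alpha> B"
  shows "h \<alpha> < \<alpha> \<and> is_eps (h \<alpha>)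
    \<and> (\<forall>x\<in>Delta \<alpha> B. Ep x \<inter> {..<\<alpha>} \<subseteq> {..<h \<alpha>} \<and> subst \<alpha> (h \<alpha>) x \<le> h x)
    \<and> (le1 \<alpha> (Max (Delta \<alpha> B)) \<longrightarrow>
         iso_plus_omega (Delta \<alpha> B) (\<lambda>x. subst \<alpha> (h \<alpha>) x)
         \<and> (\<forall>x\<in>Delta \<alpha> B. x < \<alpha> \<longrightarrow> subst \<alpha> (h \<alpha>) x = x))"
proof -
  interpret big_ordinals "TYPE('a)" by unfold_locales (rule big)
  note e = FB_eps[OF eps Bne hFB]
  \<comment> \<open>The fixed epsilon number \<open>e\<close> of the locale is instantiated by
    \<open>h \<alpha>\<close>, which \<open>FB_eps\<close> shows to be an epsilon number below
    \<alpha>.\<close>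
  interpret delta_iso "TYPE('a)" \<alpha> "h \<alpha>" B h
    by unfold_locales (use eps e finB Bsub Bne hFB in auto)
  have "Ep x \<inter> {..<\<alpha>} \<subseteq> {..<h \<alpha>}" if "x \<in> Delta \<alpha> B" for x
    using that D_subset_K by (auto simp: K_def)
  then show ?thesis
    using e star_le_h iso_plus_omega_star star_less_alpha by blast
qed

end
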